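(* There is a constant $c$ such that for every $f\in L^1(W^B_\kappa;B^d)$ and every $x\in B^d$, $$\mathcal M^B_\kappa f(x)\le c\sum_{\varepsilon\in\mathbb Z_2^d}M^B_\kappa f(x\varepsilon).$$
   Context: $B^d=\{x\in\mathbb R^d:\|x\|\le1\}$; $\kappa=(\kappa_1,\dots,\kappa_{d+1})$, $\kappa_i\ge0$; $W^B_\kappa(x)=\prod_{i=1}^d|x_i|^{2\kappa_i}(1-\|x\|^2)^{\kappa_{d+1}-1/2}$. $V_\kappa$ is the operator on functions on $\mathbb R^{d+1}$: $V_\kappa g(z)=c_\kappa\int_{[-1,1]^{d+1}}g(z_1t_1,\dots,z_{d+1}t_{d+1})\prod_{i=1}^{d+1}(1+t_i)(1-t_i^2)^{\kappa_i-1}dt$, $V_\kappa1=1$ (factors with $\kappa_i=0$ via the limit $\frac12[g(1)+g(-1)]$). $V^B_\kappa g(x,x_{d+1})=\frac12[V_\kappa g(x,x_{d+1})+V_\kappa g(x,-x_{d+1})]$; $e(x,\theta)=\{(y,y_{d+1})\in\mathbb R^{d+1}:\|(y,y_{d+1})\|\le1,\ \langle x,y\rangle+\sqrt{1-\|x\|^2}y_{d+1}\ge\cos\theta,\ y_{d+1}\ge0\}$; $Y=(y,\sqrt{1-\|y\|^2})$; $$\mathcal M^B_\kappa f(x)=\sup_{0<\theta\le\pi}\frac{\int_{B^d}|f(y)|V^B_\kappa[\chi_{e(x,\theta)}](Y)W^B_\kappa(y)dy}{\int_{B^d}V^B_\kappa[\chi_{e(x,\theta)}](Y)W^B_\kappa(y)dy}.$$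 $d_B(x,y)=\arccos(\langle x,y\rangle+\sqrt{1-\|x\|^2}\sqrt{1-\|y\|^2})$ and $M^B_\kappa f(x)=\sup_{0<\theta\le\pi}\frac{\int_{d_B(x,y)\le\theta}|f(y)|W^B_\kappa(y)dy}{\int_{d_B(x,y)\le\theta}W^B_\kappa(y)dy}$. For $\varepsilon\in\{-1,1\}^d$, $x\varepsilon=(x_1\varepsilon_1,\dots,x_d\varepsilon_d)$. *)

theory Defs
  imports "HOL-Analysis.Analysis" "HOL-Probability.Probability"
begin

text \<open>Dimension d = CARD('n); points of R^d are real^'n, points of R^(d+1) are
  pairs (y, y_(d+1)) :: (real^'n) \<times> real. kappa = (kap, kapd) with kap :: real^'n the first
  d parameters and kapd = kappa_(d+1).\<close>

text \<open>One-dimensional normalized base measure (1-t^2)^(k-1) dt on [-1,1]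
  (normalization product = c_kappa); for k = 0 the limit (delta_1 + delta_(-1))/2.\<close>
definition nuk :: "real \<Rightarrow> real measure" where
  "nuk k = (if k = 0 then distr (measure_pmf (pmf_of_set {-1, 1::real})) borel id
            else density lborel (\<lambda>t. ennreal (indicator {-1..1} t * (1 - t\<^sup>2) powr (k - 1)
                   / integral {-1..1} (\<lambda>s. (1 - s\<^sup>2) powr (k - 1)))))"

definition Vk :: "real^'n \<Rightarrow> real \<Rightarrow> ((real^'n) \<times> real \<Rightarrow> real) \<Rightarrow> (real^'n) \<times> real \<Rightarrow> real" where
  "Vk kap kapd g z =
     (\<integral>p. g ((\<chi> i. fst z $ i * fst p i), snd z * snd p)
            * (\<Prod>i\<in>UNIV. 1 + fst p i) * (1 + snd p)
        \<partial>(PiM UNIV (\<lambda>i. nuk (kap $ i)) \<Otimes>\<^sub>M nuk kapd))"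

definition VBk :: "real^'n \<Rightarrow> real \<Rightarrow> ((real^'n) \<times> real \<Rightarrow> real) \<Rightarrow> (real^'n) \<times> real \<Rightarrow> real" where
  "VBk kap kapd g z = (Vk kap kapd g (fst z, snd z) + Vk kap kapd g (fst z, - snd z)) / 2"

definition WB :: "real^'n \<Rightarrow> real \<Rightarrow> real^'n \<Rightarrow> real" where
  "WB kap kapd x = (\<Prod>i\<in>UNIV. if kap $ i = 0 then 1 else \<bar>x $ i\<bar> powr (2 * kap $ i))
                   * (1 - (norm x)\<^sup>2) powr (kapd - 1/2)"

definition muB :: "real^'n \<Rightarrow> real \<Rightarrow> (real^'n) measure" where
  "muB kap kapd = density lborel (\<lambda>y. ennreal (indicator (cball 0 1) y * WB kap kapd y))"

definition ecap :: "real^'n \<Rightarrow> real \<Rightarrow> ((real^'n) \<times> real) set" where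
  "ecap x \<theta> = {(y, yd). norm (y, yd) \<le> 1 \<and> inner x y + sqrt (1 - (norm x)\<^sup>2) * yd \<ge> cos \<theta> \<and> yd \<ge> 0}"

definition liftY :: "real^'n \<Rightarrow> (real^'n) \<times> real" where
  "liftY y = (y, sqrt (1 - (norm y)\<^sup>2))"

definition calMB :: "real^'n \<Rightarrow> real \<Rightarrow> (real^'n \<Rightarrow> real) \<Rightarrow> real^'n \<Rightarrow> ennreal" where
  "calMB kap kapd f x = (SUP \<theta>\<in>{0<..pi}.
      (\<integral>\<^sup>+ y. ennreal (\<bar>f y\<bar> * VBk kap kapd (indicator (ecap x \<theta>)) (liftY y)) \<partial>muB kap kapd)
      / (\<integral>\<^sup>+ y. ennreal (VBk kap kapd (indicator (ecap x \<theta>)) (liftY y)) \<partial>muB kap kapd))"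

definition dB :: "real^'n \<Rightarrow> real^'n \<Rightarrow> real" where
  "dB x y = arccos (inner x y + sqrt (1 - (norm x)\<^sup>2) * sqrt (1 - (norm y)\<^sup>2))"

definition MB :: "real^'n \<Rightarrow> real \<Rightarrow> (real^'n \<Rightarrow> real) \<Rightarrow> real^'n \<Rightarrow> ennreal" where
  "MB kap kapd f x = (SUP \<theta>\<in>{0<..pi}.
      (\<integral>\<^sup>+ y. ennreal (\<bar>f y\<bar> * indicator {y. dB x y \<le> \<theta>} y) \<partial>muB kap kapd)
      / emeasure (muB kap kapd) {y. dB x y \<le> \<theta>})"

end

theory Submission
  imports Defs
begin

text \<open>
  Lift \<open>x\<close> to \<open>X = (x, sqrt (1 - \<parallel>x\<parallel>\<^sup>2))\<close> on the upper hemisphere and put \<open>u\<^sub>j = (\<theta> / (\<bar>X\<^sub>j\<bar> + \<theta>))\<^sup>2\<close>. On the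
  support of \<open>\<chi>\<^sub>e(y\<^sub>1t\<^sub>1, \<dots>)\<close> each \<open>t\<^sub>j\<close> satisfies \<open>1 - \<bar>t\<^sub>j\<bar> \<le> 9 u\<^sub>j\<close>, so \<open>V\<^sup>B[\<chi>\<^sub>e](Y)\<close> is at most a constant
  times \<open>A = \<Prod>\<^sub>j u\<^sub>j powr \<kappa>\<^sub>j\<close>, and it vanishes unless \<open>y\<close> lies in one of the balls \<open>d\<^sub>B(x\<epsilon>, y) \<le> \<theta>\<close>.
  Conversely it is at least a constant times \<open>A\<close> if \<open>d\<^sub>B(x, y) \<le> \<theta>/2\<close> and \<open>y\<close> lies in the same
  closed octant as \<open>x\<close>. The factors \<open>A\<close> cancel in the quotient, and what remains is the doubling
  property of the weighted measure on same-octant caps.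

  For doubling, the measure is written as an integral over the half shell
  \<open>1/2 \<le> \<parallel>z\<parallel> \<le> 1\<close>, \<open>z\<^sub>d\<^sub>+\<^sub>1 > 0\<close> of \<open>\<real>\<^sup>d\<^sup>+\<^sup>1\<close>, where the singular factor \<open>(1 - \<parallel>y\<parallel>\<^sup>2) powr (-1/2)\<close> disappears.
  There the affine map \<open>z \<mapsto> 2/3 X + 1/3 z\<close> halves the angle to \<open>X\<close>, has constant Jacobian, and in the
  octant of \<open>X\<close> it decreases every coordinate by at most a constant factor.
\<close>

section \<open>The one-dimensional measures\<close>

lemma space_nuk [simp]: "space (nuk k) = UNIV"
  by (simp add: nuk_def)

lemma sets_nuk [simp, measurable_cong]: "sets (nuk k) = sets borel"
  by (simp add: nuk_def)

lemma nn_integral_powr_right: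
  fixes k u :: real
  assumes "k > 0" "u \<ge> 0"
  shows "(\<integral>\<^sup>+t. ennreal (indicator {1-u..1} t * (1 - t) powr (k - 1)) \<partial>lborel) = ennreal (u powr k / k)"
proof -
  have "(\<integral>\<^sup>+t. ennreal (indicator {1-u..1} t * (1 - t) powr (k - 1)) \<partial>lborel)
     = (\<integral>\<^sup>+t. ennreal (indicator {0..u} t * t powr (k - 1)) \<partial>lborel)"
    by (subst nn_integral_real_affine[where c="-1" and t=1])
      (auto intro!: nn_integral_cong simp: indicator_def)
  also have "\<dots> = ennreal (u powr k / k)"
    using nn_integral_has_integral_lebesgue[OF _ has_integral_powr_from_0[of "k-1" u]] assms
    by simp
  finally show ?thesis .
qed

text \<open>Unnormalised mass of the Jacobi weight. It is kept as a nonnegative integral, so that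
  its finiteness can be derived from estimates before it is compared with the
  \<open>integral\<close> in \<open>nuk\<close>.\<close>

definition jacobi_mass :: "real \<Rightarrow> real set \<Rightarrow> ennreal" where
  "jacobi_mass k S = (\<integral>\<^sup>+t. ennreal (indicator (S \<inter> {-1..1}) t * (1 - t\<^sup>2) powr (k - 1)) \<partial>lborel)"

lemma powr_between:
  fixes a p :: real
  assumes "1 \<le> a" "a \<le> 2"
  shows "a powr p \<le> 2 powr \<bar>p\<bar>" "2 powr (-\<bar>p\<bar>) \<le> a powr p"
proof -
  have "a powr p \<le> a powr \<bar>p\<bar>" using assms by (intro powr_mono) auto
  also have "\<dots> \<le> 2 powr \<bar>p\<bar>" using assms by (intro powr_mono2) auto
  finally show "a powr p \<le> 2 powr \<bar>p\<bar>" .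
  have "2 powr (-\<bar>p\<bar>) \<le> a powr (-\<bar>p\<bar>)" using assms by (intro powr_mono2') auto
  also have "\<dots> \<le> a powr p" using assms by (intro powr_mono) auto
  finally show "2 powr (-\<bar>p\<bar>) \<le> a powr p" .
qed

text \<open>Split \<open>1 - t\<^sup>2 = (1 + t) * (1 - t)\<close>. On this interval
  \<open>1 + t\<close> lies in [1,2] and contributes only powers of 2; the other factor integrates
  to \<open>u powr k / k\<close>. The modulus in the exponent covers both signs of
  \<open>k - 1\<close>.\<close>

lemma jacobi_mass_right:
  assumes "k > 0" "0 \<le> u" "u \<le> 1"
  shows "jacobi_mass k {1-u..1} \<le> ennreal (2 powr \<bar>k-1\<bar> * u powr k / k)"
    and "ennreal (2 powr (-\<bar>k-1\<bar>) * u powr k / k) \<le> jacobi_mass k {1-u..1}"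
proof -
  have fact: "(1 - t\<^sup>2) powr (k-1) = (1 + t) powr (k-1) * (1 - t) powr (k-1)" if "t \<in> {1-u..1}" for t
    using that assms by (subst powr_mult[symmetric]) (auto simp: algebra_simps power2_eq_square)
  have scale: "ennreal (C * u powr k / k)
      = (\<integral>\<^sup>+t. ennreal C * ennreal (indicator {1-u..1} t * (1 - t) powr (k - 1)) \<partial>lborel)"
    if "C \<ge> 0" for C
    using that assms
    by (subst nn_integral_cmult) (auto simp: nn_integral_powr_right ennreal_mult'[symmetric])
  show "jacobi_mass k {1-u..1} \<le> ennreal (2 powr \<bar>k-1\<bar> * u powr k / k)"
    unfolding jacobi_mass_def
    by (subst scale) (use assms in \<open>auto intro!: nn_integral_mono mult_right_mono powr_between
        simp: fact indicator_def ennreal_mult'[symmetric]\<close>)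
  show "ennreal (2 powr (-\<bar>k-1\<bar>) * u powr k / k) \<le> jacobi_mass k {1-u..1}"
    unfolding jacobi_mass_def
    by (subst scale) (use assms in \<open>auto intro!: nn_integral_mono mult_right_mono powr_between
        simp: fact indicator_def ennreal_mult'[symmetric]\<close>)
qed

text \<open>The weight is even, so the left end of the interval carries the same mass as the right
  end.\<close>

lemma jacobi_mass_collar:
  assumes "k > 0" "0 \<le> u" "u \<le> 1"
  shows "jacobi_mass k {t. 1 - \<bar>t\<bar> \<le> u} \<le> ennreal (2 * 2 powr \<bar>k-1\<bar> * u powr k / k)"
proof -
  have "jacobi_mass k {-1..u-1} = jacobi_mass k {1-u..1}"
    unfolding jacobi_mass_def
    by (subst nn_integral_real_affine[where c="-1" and t=0])
      (auto intro!: nn_integral_cong simp: indicator_def)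
  moreover have "jacobi_mass k {t. 1 - \<bar>t\<bar> \<le> u} \<le> jacobi_mass k {-1..u-1} + jacobi_mass k {1-u..1}"
    unfolding jacobi_mass_def
    by (subst nn_integral_add[symmetric])
      (auto intro!: nn_integral_mono simp: indicator_def ennreal_plus[symmetric] simp del: ennreal_plus)
  ultimately have "jacobi_mass k {t. 1 - \<bar>t\<bar> \<le> u} \<le> ennreal (2 powr \<bar>k-1\<bar> * u powr k / k) + ennreal (2 powr \<bar>k-1\<bar> * u powr k / k)"
    using jacobi_mass_right(1)[OF assms] by (metis add_mono order_trans)
  also have "\<dots> = ennreal (2 * 2 powr \<bar>k-1\<bar> * u powr k / k)"
    using assms by (subst ennreal_plus[symmetric]) (auto simp: field_simps)
  finally show ?thesis .
qed

text \<open>Links the normalising constant of \<open>nuk\<close>, a gauge integral, with the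
  nonnegative integral. Finiteness is the collar bound at \<open>u = 1\<close>; positivity already
  comes from the half [0,1].\<close>

lemma jacobi_mass_total:
  assumes "k > 0"
  defines "I \<equiv> integral {-1..1} (\<lambda>s. (1 - s\<^sup>2) powr (k - 1))"
  shows "jacobi_mass k UNIV = ennreal I" "I > 0"
proof -
  let ?J = "jacobi_mass k UNIV"
  have eq: "{t::real. 1 - \<bar>t\<bar> \<le> 1} = UNIV" by auto
  have fin: "?J < \<infinity>"
    using jacobi_mass_collar[OF assms(1), of 1] unfolding eq by (simp add: order_le_less_trans)
  have "0 < ennreal (2 powr (-\<bar>k-1\<bar>) / k)" using assms by simp
  also have "\<dots> \<le> jacobi_mass k {0..1}" using jacobi_mass_right(2)[OF assms(1), of 1] by simp
  also have "\<dots> \<le> ?J" unfolding jacobi_mass_def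
    by (intro nn_integral_mono) (auto simp: indicator_def)
  finally have pos: "0 < ?J" .
  let ?f = "\<lambda>t::real. indicator {-1..1} t * (1 - t\<^sup>2) powr (k - 1)"
  have "(?f has_integral enn2real ?J) UNIV"
    by (rule nn_integral_has_integral) (use fin in \<open>auto simp: jacobi_mass_def\<close>)
  then have "((\<lambda>t. if t \<in> {-1..1} then (1 - t\<^sup>2) powr (k - 1) else 0) has_integral enn2real ?J) UNIV"
    by (rule has_integral_eq[rotated]) auto
  then have "((\<lambda>t. (1 - t\<^sup>2) powr (k - 1)) has_integral enn2real ?J) {-1..1}"
    by (subst (asm) has_integral_restrict_UNIV)
  then have "I = enn2real ?J" unfolding I_def by (rule integral_unique)
  then show "?J = ennreal I" "I > 0" using fin pos by (auto simp: enn2real_positive_iff)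
qed

lemma emeasure_nuk:
  assumes "k > 0" "S \<in> sets borel"
  shows "emeasure (nuk k) S = jacobi_mass k S / jacobi_mass k UNIV"
proof -
  have I: "integral {-1..1} (\<lambda>s. (1 - s\<^sup>2) powr (k - 1)) > 0" (is "?I > 0")
    using jacobi_mass_total[OF assms(1)] by simp
  have "emeasure (nuk k) S = (\<integral>\<^sup>+t. ennreal (indicator {-1..1} t * (1 - t\<^sup>2) powr (k - 1) / ?I) * indicator S t \<partial>lborel)"
    using assms by (simp add: nuk_def emeasure_density)
  also have "\<dots> = (\<integral>\<^sup>+t. ennreal (indicator (S \<inter> {-1..1}) t * (1 - t\<^sup>2) powr (k - 1)) / ennreal ?I \<partial>lborel)"
    using I by (intro nn_integral_cong) (auto simp: indicator_def divide_ennreal)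
  also have "\<dots> = jacobi_mass k S / ennreal ?I"
    unfolding jacobi_mass_def using assms(2) by (intro nn_integral_divide) simp
  finally show ?thesis using jacobi_mass_total[OF assms(1)] by simp
qed

lemma emeasure_nuk_0:
  assumes "S \<in> sets borel"
  shows "emeasure (nuk 0) S = ennreal ((indicator S (-1) + indicator S 1) / 2)"
proof -
  have "emeasure (nuk 0) S = emeasure (measure_pmf (pmf_of_set {-1, 1::real})) S"
    using assms by (simp add: nuk_def emeasure_distr)
  also have "\<dots> = ennreal (real (card ({-1, 1} \<inter> S)) / 2)"
    by (subst emeasure_pmf_of_set) auto
  also have "real (card ({-1, 1::real} \<inter> S)) = indicator S (-1) + indicator S 1"
    by (auto simp: indicator_def Int_insert_left)
  finally show ?thesis .
qed

lemma prob_space_nuk: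
  assumes "k \<ge> 0"
  shows "prob_space (nuk k)"
proof (cases "k = 0")
  case True
  then show ?thesis by (intro prob_spaceI) (simp add: emeasure_nuk_0)
next
  case False
  then have "k > 0" using assms by simp
  then show ?thesis using jacobi_mass_total[OF \<open>k > 0\<close>]
    by (intro prob_spaceI) (simp add: emeasure_nuk divide_ennreal)
qed

lemma emeasure_nuk_interval:
  assumes "k \<ge> 0"
  shows "emeasure (nuk k) {-1..1} = 1"
proof (cases "k = 0")
  case False
  then have k: "k > 0" using assms by simp
  have "jacobi_mass k {-1..1} = jacobi_mass k UNIV" by (simp add: jacobi_mass_def)
  then show ?thesis using jacobi_mass_total[OF k] k by (simp add: emeasure_nuk divide_ennreal)
qed (simp add: emeasure_nuk_0)

text \<open>For \<open>u \<le> 1\<close> this is the collar estimate. Larger \<open>u\<close> must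
  be allowed because the widths used later are \<open>9 * ratio\<close>; there the total mass 1 is
  at most \<open>u powr k\<close>. At \<open>k = 0\<close> the right side is constant and only total
  mass 1 is used.\<close>

lemma nuk_collar_upper:
  assumes "k \<ge> 0"
  shows "\<exists>C>0. \<forall>u>0. measure (nuk k) {t. 1 - \<bar>t\<bar> \<le> u} \<le> C * u powr k"
proof -
  interpret prob_space "nuk k" by (rule prob_space_nuk[OF assms])
  show ?thesis
  proof (cases "k = 0")
    case True
    then show ?thesis using prob_le_1 by (intro exI[of _ 1]) auto
  next
    case False
    then have k: "k > 0" using assms by simp
    define I where "I = integral {-1..1} (\<lambda>s. (1 - s\<^sup>2) powr (k - 1))"
    have I: "jacobi_mass k UNIV = ennreal I" "I > 0" using jacobi_mass_total[OF k] by (auto simp: I_def)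
    define C where "C = max 1 (2 * 2 powr \<bar>k-1\<bar> / k / I)"
    have "measure (nuk k) {t. 1 - \<bar>t\<bar> \<le> u} \<le> C * u powr k" if u: "u > 0" for u
    proof (cases "u \<le> 1")
      case True
      have "emeasure (nuk k) {t. 1 - \<bar>t\<bar> \<le> u} \<le> ennreal (2 * 2 powr \<bar>k-1\<bar> * u powr k / k) / ennreal I"
        using k u True I by (auto simp: emeasure_nuk intro!: divide_right_mono_ennreal jacobi_mass_collar)
      also have "\<dots> = ennreal (2 * 2 powr \<bar>k-1\<bar> / k / I * u powr k)"
        using k I by (simp add: divide_ennreal field_simps)
      finally have "measure (nuk k) {t. 1 - \<bar>t\<bar> \<le> u} \<le> 2 * 2 powr \<bar>k-1\<bar> / k / I * u powr k"
        using k I by (subst (asm) emeasure_eq_measure) (auto simp: ennreal_le_iff)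
      also have "\<dots> \<le> C * u powr k" by (intro mult_right_mono) (auto simp: C_def)
      finally show ?thesis .
    next
      case False
      have "measure (nuk k) {t. 1 - \<bar>t\<bar> \<le> u} \<le> 1" by simp
      also have "\<dots> \<le> u powr k" using False k by (simp add: ge_one_powr_ge_zero)
      also have "\<dots> \<le> C * u powr k" by (auto simp: C_def mult_le_cancel_right1)
      finally show ?thesis .
    qed
    moreover have "C > 0" by (simp add: C_def)
    ultimately show ?thesis by auto
  qed
qed

text \<open>Only the right end is measured: there the factor \<open>1 + t\<close> of
  \<open>Vk\<close> is at least 1, while it degenerates at the left end. At \<open>k = 0\<close> the
  atom at 1 contributes 1/2.\<close>

lemma nuk_collar_lower:
  assumes "k \<ge> 0"
  shows "\<exists>c>0. \<forall>u. 0 < u \<and> u \<le> 1 \<longrightarrow> c * u powr k \<le> measure (nuk k) {1-u..1}"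
proof -
  interpret prob_space "nuk k" by (rule prob_space_nuk[OF assms])
  show ?thesis
  proof (cases "k = 0")
    case True
    then show ?thesis
      by (intro exI[of _ "1/2"]) (auto simp: measure_def emeasure_nuk_0 enn2real_ennreal simp del: ennreal_half)
  next
    case False
    then have k: "k > 0" using assms by simp
    define I where "I = integral {-1..1} (\<lambda>s. (1 - s\<^sup>2) powr (k - 1))"
    have I: "jacobi_mass k UNIV = ennreal I" "I > 0" using jacobi_mass_total[OF k] by (auto simp: I_def)
    define c where "c = 2 powr (-\<bar>k-1\<bar>) / k / I"
    have "c * u powr k \<le> measure (nuk k) {1-u..1}" if u: "0 < u" "u \<le> 1" for u
    proof -
      have "ennreal (c * u powr k) = ennreal (2 powr (-\<bar>k-1\<bar>) * u powr k / k) / ennreal I"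
        using k I by (simp add: divide_ennreal field_simps c_def)
      also have "\<dots> \<le> emeasure (nuk k) {1-u..1}"
        using k u I by (auto simp: emeasure_nuk intro!: divide_right_mono_ennreal jacobi_mass_right)
      finally show ?thesis by (subst (asm) emeasure_eq_measure) (auto simp: ennreal_le_iff)
    qed
    moreover have "c > 0" using k I by (simp add: c_def)
    ultimately show ?thesis by auto
  qed
qed

section \<open>The intertwining operator on indicators\<close>

lemma measurable_dilate [measurable]:
  fixes z :: "(real^'n) \<times> real"
  shows "(\<lambda>p. ((\<chi> i. fst z $ i * fst p i), snd z * snd p))
     \<in> (PiM UNIV (\<lambda>i. nuk (kap $ i)) \<Otimes>\<^sub>M nuk kapd) \<rightarrow>\<^sub>M borel"
proof (rule borel_measurable_Pair)
  show "(\<lambda>p. \<chi> i. fst z $ i * fst p i) \<in> borel_measurable (PiM UNIV (\<lambda>i. nuk (kap $ i)) \<Otimes>\<^sub>M nuk kapd)"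
    by (subst borel_measurable_euclidean_space) (auto simp: Basis_vec_def inner_axis)
qed measurable

lemma prod_one_plus_bounds:
  fixes t :: "'n::finite \<Rightarrow> real" and s :: real
  assumes "\<forall>i. \<bar>t i\<bar> \<le> 1" "\<bar>s\<bar> \<le> 1"
  shows "0 \<le> (\<Prod>i\<in>UNIV. 1 + t i) * (1 + s)" and "(\<Prod>i\<in>UNIV. 1 + t i) * (1 + s) \<le> 2 ^ (CARD('n) + 1)"
proof -
  have b: "0 \<le> 1 + t i" "1 + t i \<le> 2" for i
    using spec[OF assms(1), of i] by linarith+
  have s: "0 \<le> 1 + s" "1 + s \<le> 2" using assms(2) by linarith+
  show "0 \<le> (\<Prod>i\<in>UNIV. 1 + t i) * (1 + s)"
    using b s by (intro mult_nonneg_nonneg prod_nonneg) auto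
  have "(\<Prod>i\<in>UNIV. 1 + t i) \<le> (\<Prod>i\<in>(UNIV::'n set). 2)"
    using b by (intro prod_mono) auto
  then have "(\<Prod>i\<in>UNIV. 1 + t i) * (1 + s) \<le> 2 ^ CARD('n) * 2"
    using s b by (intro mult_mono prod_nonneg) auto
  then show "(\<Prod>i\<in>UNIV. 1 + t i) * (1 + s) \<le> 2 ^ (CARD('n) + 1)" by simp
qed

context
  fixes kap :: "real^'n" and kapd :: real
  assumes kap: "\<And>i. kap $ i \<ge> 0" and kapd: "kapd \<ge> 0"
begin

abbreviation "nu_prod \<equiv> PiM UNIV (\<lambda>i. nuk (kap $ i)) \<Otimes>\<^sub>M nuk kapd"

lemma prob_space_nu_prod: "prob_space nu_prod"
proof -
  interpret A: prob_space "PiM UNIV (\<lambda>i. nuk (kap $ i))"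
    by (intro prob_space_PiM prob_space_nuk kap)
  interpret B: prob_space "nuk kapd" by (intro prob_space_nuk kapd)
  interpret pair_prob_space "PiM UNIV (\<lambda>i. nuk (kap $ i))" "nuk kapd" ..
  show ?thesis by unfold_locales
qed

lemma
  assumes "\<And>i. U i \<in> sets borel" "V \<in> sets borel"
  shows sets_nu_box: "PiE UNIV U \<times> V \<in> sets nu_prod"
    and measure_nu_box: "measure nu_prod (PiE UNIV U \<times> V)
      = (\<Prod>i\<in>UNIV. measure (nuk (kap $ i)) (U i)) * measure (nuk kapd) V"
proof -
  interpret N: prob_space "nuk (kap $ i)" for i by (intro prob_space_nuk kap)
  interpret A: finite_product_prob_space "\<lambda>i. nuk (kap $ i)" UNIV
    by unfold_locales auto
  interpret B: prob_space "nuk kapd" by (intro prob_space_nuk kapd)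
  have U: "PiE UNIV U \<in> sets (PiM UNIV (\<lambda>i. nuk (kap $ i)))"
    using assms by (intro sets_PiM_I_finite) auto
  then show "PiE UNIV U \<times> V \<in> sets nu_prod" using assms by auto
  show "measure nu_prod (PiE UNIV U \<times> V)
      = (\<Prod>i\<in>UNIV. measure (nuk (kap $ i)) (U i)) * measure (nuk kapd) V"
    using assms U
    by (simp add: measure_def B.emeasure_pair_measure_Times enn2real_mult)
      (simp add: measure_def[symmetric] A.prob_times)
qed

text \<open>Each \<open>nuk\<close> is a measure on the whole line, so bounds on the kernel factor,
  valid on the cube, hold only almost everywhere.\<close>

lemma AE_nu_prod: "AE p in nu_prod. (\<forall>i. \<bar>fst p i\<bar> \<le> 1) \<and> \<bar>snd p\<bar> \<le> 1"
proof -
  interpret prob_space nu_prod by (rule prob_space_nu_prod)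
  let ?B = "PiE UNIV (\<lambda>_::'n. {-1..1::real}) \<times> {-1..1::real}"
  have 1: "measure (nuk k) {-1..1} = 1" if "k \<ge> 0" for k
    using emeasure_nuk_interval[OF that] by (simp add: measure_def)
  have "measure nu_prod ?B = 1" by (subst measure_nu_box) (auto simp: 1 kap kapd)
  then have "AE p in nu_prod. p \<in> ?B"
    by (intro AE_in_set_eq_1[THEN iffD2] sets_nu_box) auto
  then show ?thesis by eventually_elim (auto simp: PiE_iff abs_le_iff)
qed

text \<open>If the dilated point can lie in \<open>S\<close> only for parameters in a box, the
  integral is at most the mass of the box times the bound \<open>2 ^ (d+1)\<close> on the kernel
  factor.\<close>

lemma Vk_indicator_le:
  fixes S :: "((real^'n) \<times> real) set"
  assumes meas: "\<And>i. U i \<in> sets borel" "V \<in> sets borel"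
    and sub: "\<And>t s. \<lbrakk>\<And>i. \<bar>t i\<bar> \<le> 1; \<bar>s\<bar> \<le> 1; ((\<chi> i. fst z $ i * t i), snd z * s) \<in> S\<rbrakk>
      \<Longrightarrow> (\<forall>i. t i \<in> U i) \<and> s \<in> V"
  shows "Vk kap kapd (indicator S) z
     \<le> 2 ^ (CARD('n) + 1) * ((\<Prod>i\<in>UNIV. measure (nuk (kap $ i)) (U i)) * measure (nuk kapd) V)"
proof -
  interpret prob_space nu_prod by (rule prob_space_nu_prod)
  let ?B = "PiE UNIV U \<times> V"
  have "Vk kap kapd (indicator S) z \<le> (\<integral>p. 2 ^ (CARD('n) + 1) * indicator ?B p \<partial>nu_prod)"
    unfolding Vk_def
  \<comment> \<open>Domination by an integrable nonnegative majorant suffices: a non-integrable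
    integrand would have integral 0 by convention.\<close>
  proof (rule integral_mono_AE')
    show "integrable nu_prod (\<lambda>p. 2 ^ (CARD('n) + 1) * indicator ?B p :: real)"
      using sets_nu_box[OF meas] by (intro integrable_mult_right integrable_real_indicator) (auto simp: emeasure_eq_measure)
    show "AE p in nu_prod. indicator S (\<chi> i. fst z $ i * fst p i, snd z * snd p)
        * (\<Prod>i\<in>UNIV. 1 + fst p i) * (1 + snd p) \<le> 2 ^ (CARD('n) + 1) * indicator ?B p"
      using AE_nu_prod
    proof eventually_elim
      case (elim p)
      show ?case
      proof (cases "(\<chi> i. fst z $ i * fst p i, snd z * snd p) \<in> S")
        case True
        then have "p \<in> ?B" using sub[of "fst p" "snd p"] elim by (cases p) (auto simp: PiE_iff)
        then show ?thesis using elim True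
          prod_one_plus_bounds(2)[of "fst p" "snd p"] by (simp add: mult.assoc)
      qed auto
    qed
  qed auto
  also have "\<dots> = 2 ^ (CARD('n) + 1) * measure nu_prod ?B"
    using sets_nu_box[OF meas] by simp
  finally show ?thesis by (simp only: measure_nu_box[OF meas])
qed

lemma Vk_indicator_nonneg: "0 \<le> Vk kap kapd (indicator S) z"
  unfolding Vk_def
proof (rule integral_nonneg_AE)
  show "AE p in nu_prod. 0 \<le> indicator S (\<chi> i. fst z $ i * fst p i, snd z * snd p)
        * (\<Prod>i\<in>UNIV. 1 + fst p i) * (1 + snd p)"
    using AE_nu_prod
  proof eventually_elim
    case (elim p)
    then have "0 \<le> (\<Prod>i\<in>UNIV. 1 + fst p i) * (1 + snd p)" by (intro prod_one_plus_bounds; simp)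
    then show ?case by (simp only: mult.assoc) (simp add: indicator_def)
  qed
qed

lemma Vk_indicator_ge:
  fixes S :: "((real^'n) \<times> real) set"
  assumes meas: "\<And>i. U i \<in> sets borel" "V \<in> sets borel" and S [measurable]: "S \<in> sets borel"
    and unit: "\<And>i. U i \<subseteq> {0..1}" "V \<subseteq> {0..1}"
    and sub: "\<And>t s. \<lbrakk>\<And>i. t i \<in> U i; s \<in> V\<rbrakk> \<Longrightarrow> ((\<chi> i. fst z $ i * t i), snd z * s) \<in> S"
  shows "(\<Prod>i\<in>UNIV. measure (nuk (kap $ i)) (U i)) * measure (nuk kapd) V \<le> Vk kap kapd (indicator S) z"
proof -
  interpret prob_space nu_prod by (rule prob_space_nu_prod)
  let ?B = "PiE UNIV U \<times> V"
  have "(\<Prod>i\<in>UNIV. measure (nuk (kap $ i)) (U i)) * measure (nuk kapd) V = measure nu_prod ?B"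
    by (simp only: measure_nu_box[OF meas])
  also have "\<dots> = (\<integral>p. indicator ?B p \<partial>nu_prod)"
    using sets_nu_box[OF meas] by simp
  also have "\<dots> \<le> Vk kap kapd (indicator S) z"
    unfolding Vk_def
  proof (rule integral_mono_AE)
    show "integrable nu_prod (indicator ?B :: _ \<Rightarrow> real)"
      using sets_nu_box[OF meas] by (intro integrable_real_indicator) (auto simp: emeasure_eq_measure)
    let ?w = "\<lambda>p::('n \<Rightarrow> real) \<times> real. (\<Prod>i\<in>UNIV. 1 + fst p i) * (1 + snd p)"
    let ?f = "\<lambda>p. indicator S (\<chi> i. fst z $ i * fst p i, snd z * snd p)
        * (\<Prod>i\<in>UNIV. 1 + fst p i) * (1 + snd p) :: real"
    show "integrable nu_prod ?f"
    proof (rule integrable_const_bound)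
      show "AE p in nu_prod. norm (?f p) \<le> 2 ^ (CARD('n) + 1)"
        using AE_nu_prod
      proof eventually_elim
        case (elim p)
        then have "0 \<le> ?w p" "?w p \<le> 2 ^ (CARD('n) + 1)" by (intro prod_one_plus_bounds; simp)+
        then show ?case by (simp only: mult.assoc) (simp add: indicator_def)
      qed
    qed measurable
    show "AE p in nu_prod. indicator ?B p \<le> ?f p"
      using AE_nu_prod
    proof eventually_elim
      case (elim p)
      show ?case
      proof (cases "p \<in> ?B")
        case True
        then have U: "fst p i \<in> U i" and V: "snd p \<in> V" for i by (auto simp: PiE_iff)
        then have "(\<chi> i. fst z $ i * fst p i, snd z * snd p) \<in> S" by (rule sub)
        moreover have "fst p i \<ge> 0" for i using U[of i] unit(1)[of i] by auto
        moreover have "snd p \<ge> 0" using V unit(2) by auto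
        moreover have "1 * 1 \<le> (\<Prod>i\<in>UNIV. 1 + fst p i) * (1 + snd p)"
          using calculation by (intro mult_mono prod_ge_1 prod_nonneg) auto
        ultimately show ?thesis using True by simp
      next
        case False
        have "0 \<le> ?w p" using elim by (intro prod_one_plus_bounds; simp)
        then have "0 \<le> ?f p" by (simp only: mult.assoc) (simp add: indicator_def)
        then show ?thesis using False by simp
      qed
    qed
  qed
  finally show ?thesis .
qed

end

section \<open>Folded caps on the hemisphere and the dilations they allow\<close>

definition lastc :: "real^'n \<Rightarrow> real" where
  "lastc x = sqrt (1 - (norm x)\<^sup>2)"

text \<open>The union over all sign vectors \<open>\<epsilon>\<close> of the balls \<open>dB (x * \<epsilon>) y \<le> \<theta>\<close>, and its part in the octant of \<open>x\<close>.\<close>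
definition foldcap :: "real^'n \<Rightarrow> real \<Rightarrow> (real^'n) set" where
  "foldcap x \<theta> = {y \<in> cball 0 1. cos \<theta> \<le> (\<Sum>i\<in>UNIV. \<bar>x $ i * y $ i\<bar>) + lastc x * lastc y}"

definition octcap :: "real^'n \<Rightarrow> real \<Rightarrow> (real^'n) set" where
  "octcap x \<theta> = {y \<in> foldcap x \<theta>. \<forall>i. 0 \<le> x $ i * y $ i}"

text \<open>The \<open>u\<close> of the overview: comparable to 1 for \<open>\<bar>s\<bar>\<close>
  up to the size of \<open>\<theta>\<close>, and to \<open>(\<theta> / s)\<^sup>2\<close> beyond. It
  is the width of the collar near \<open>\<bar>t\<bar> = 1\<close> that a cap of radius
  \<open>\<theta>\<close> leaves for the dilation of a coordinate \<open>s\<close>. The product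
  \<open>capfactor\<close> is the \<open>A\<close> of the overview.\<close>

definition ratio :: "real \<Rightarrow> real \<Rightarrow> real" where
  "ratio \<theta> s = (\<theta> / (\<bar>s\<bar> + \<theta>))\<^sup>2"

definition capfactor :: "real^'n \<Rightarrow> real \<Rightarrow> real^'n \<Rightarrow> real \<Rightarrow> real" where
  "capfactor kap kapd x \<theta> = (\<Prod>i\<in>UNIV. ratio \<theta> (x $ i) powr (kap $ i)) * ratio \<theta> (lastc x) powr kapd"

lemma norm_vec_sq: "(norm x)\<^sup>2 = (\<Sum>i\<in>UNIV. (x $ i)\<^sup>2)" for x :: "real^'n"
  by (simp add: power2_norm_eq_inner inner_vec_def) (simp add: power2_eq_square)

lemma lastc_nonneg [simp]: "x \<in> cball 0 1 \<Longrightarrow> 0 \<le> lastc x"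
  by (simp add: lastc_def abs_square_le_1)

lemma lastc_sq: "x \<in> cball 0 1 \<Longrightarrow> (lastc x)\<^sup>2 = 1 - (norm x)\<^sup>2"
  by (simp add: lastc_def abs_square_le_1)

text \<open>The lifts of \<open>x\<close> and \<open>y\<close> with all coordinates replaced by
  their moduli are unit vectors; this is the identity between their squared chordal distance and
  their inner product.\<close>

lemma fold_dist_sq:
  fixes x y :: "real^'n"
  assumes "x \<in> cball 0 1" "y \<in> cball 0 1"
  shows "(\<Sum>i\<in>UNIV. (\<bar>x $ i\<bar> - \<bar>y $ i\<bar>)\<^sup>2) + (lastc x - lastc y)\<^sup>2
    = 2 - 2 * ((\<Sum>i\<in>UNIV. \<bar>x $ i * y $ i\<bar>) + lastc x * lastc y)"
proof -
  have "(\<Sum>i\<in>UNIV. (\<bar>x $ i\<bar> - \<bar>y $ i\<bar>)\<^sup>2)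
      = (\<Sum>i\<in>UNIV. (x $ i)\<^sup>2 + (y $ i)\<^sup>2 - 2 * \<bar>x $ i * y $ i\<bar>)"
    by (intro sum.cong) (auto simp: power2_diff abs_mult)
  also have "\<dots> = (norm x)\<^sup>2 + (norm y)\<^sup>2 - 2 * (\<Sum>i\<in>UNIV. \<bar>x $ i * y $ i\<bar>)"
    by (simp add: norm_vec_sq sum.distrib sum_subtractf sum_distrib_left)
  finally show ?thesis using lastc_sq[OF assms(1)] lastc_sq[OF assms(2)]
    by (simp add: power2_diff algebra_simps)
qed

lemma one_minus_cos_le: "1 - cos t \<le> t\<^sup>2 / 2" for t :: real
proof -
  have "1 - cos t = 2 * (sin (t/2))\<^sup>2" using cos_double_sin[of "t/2"] by simp
  also have "(sin (t/2))\<^sup>2 \<le> (t/2)\<^sup>2"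
    using abs_sin_x_le_abs_x[of "t/2"] by (simp only: abs_le_square_iff)
  finally show ?thesis by (simp add: power2_eq_square)
qed

text \<open>With \<open>c = cos (t/2)\<close> the gap is \<open>(1 - c) * (1 + 2 * c)\<close>, at
  least \<open>1 - c = 2 * (sin (t/4))\<^sup>2\<close>. It is the room in which a point of the half
  cap may be dilated without leaving the full cap.\<close>

lemma cos_half_gap:
  assumes "0 < t" "t \<le> pi"
  shows "t\<^sup>2 / 32 \<le> cos (t/2) - cos t"
proof -
  have c: "cos (t/2) \<ge> 0" using assms by (intro cos_ge_zero) auto
  have "0 \<le> (1 - cos (t/2)) * (2 * cos (t/2))" using c by simp
  moreover have "cos t = 2 * (cos (t/2))\<^sup>2 - 1" using cos_double_cos[of "t/2"] by simp
  ultimately have 1: "1 - cos (t/2) \<le> cos (t/2) - cos t" by (simp add: algebra_simps power2_eq_square)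
  \<comment> \<open>The linear lower bound for the sine: the mean value point stays below
    \<open>pi/4\<close>, hence below \<open>pi/3\<close>, where the cosine is at least 1/2.\<close>
  obtain \<xi> where \<xi>: "0 < \<xi>" "\<xi> < t/4" "sin (t/4) - sin 0 = (t/4 - 0) * cos \<xi>"
    using MVT2[of 0 "t/4" sin cos] assms by auto
  have "1/2 \<le> cos \<xi>"
    using cos_monotone_0_pi_le[of \<xi> "pi/3"] assms \<xi> by (simp add: cos_60)
  then have "t/4 * (1/2) \<le> t/4 * cos \<xi>" using assms by (intro mult_left_mono) auto
  then have "t/8 \<le> sin (t/4)" using \<xi>(3) by simp
  then have "(t/8)\<^sup>2 \<le> (sin (t/4))\<^sup>2" using assms by (intro power_mono) auto
  moreover have "1 - cos (t/2) = 2 * (sin (t/4))\<^sup>2" using cos_double_sin[of "t/4"] by simp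
  ultimately show ?thesis using 1 by (simp add: power2_eq_square)
qed

text \<open>The chordal distance of the folded lifts is at most the angle \<open>\<theta>\<close>,
  and each coordinate difference is at most the chordal distance.\<close>

lemma foldcap_close:
  fixes x y :: "real^'n"
  assumes x: "x \<in> cball 0 1" and y: "y \<in> foldcap x \<theta>" and "\<theta> \<ge> 0"
  shows "\<bar>\<bar>x $ i\<bar> - \<bar>y $ i\<bar>\<bar> \<le> \<theta>" and "\<bar>lastc x - lastc y\<bar> \<le> \<theta>"
proof -
  have yb: "y \<in> cball 0 1" and c: "cos \<theta> \<le> (\<Sum>i\<in>UNIV. \<bar>x $ i * y $ i\<bar>) + lastc x * lastc y"
    using y by (auto simp: foldcap_def)
  have tot: "(\<Sum>i\<in>UNIV. (\<bar>x $ i\<bar> - \<bar>y $ i\<bar>)\<^sup>2) + (lastc x - lastc y)\<^sup>2 \<le> \<theta>\<^sup>2"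
    unfolding fold_dist_sq[OF x yb] using c one_minus_cos_le[of \<theta>] by argo
  have "(\<bar>x $ i\<bar> - \<bar>y $ i\<bar>)\<^sup>2 \<le> (\<Sum>i\<in>UNIV. (\<bar>x $ i\<bar> - \<bar>y $ i\<bar>)\<^sup>2)"
    by (intro member_le_sum) auto
  then have "(\<bar>x $ i\<bar> - \<bar>y $ i\<bar>)\<^sup>2 \<le> \<theta>\<^sup>2"
    using tot zero_le_power2[of "lastc x - lastc y"] by linarith
  then show "\<bar>\<bar>x $ i\<bar> - \<bar>y $ i\<bar>\<bar> \<le> \<theta>"
    using \<open>\<theta> \<ge> 0\<close> abs_le_square_iff[of "\<bar>x $ i\<bar> - \<bar>y $ i\<bar>" \<theta>] by simp
  have "0 \<le> (\<Sum>i\<in>UNIV. (\<bar>x $ i\<bar> - \<bar>y $ i\<bar>)\<^sup>2)" by (intro sum_nonneg) auto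
  then have "(lastc x - lastc y)\<^sup>2 \<le> \<theta>\<^sup>2" using tot by linarith
  then show "\<bar>lastc x - lastc y\<bar> \<le> \<theta>"
    using \<open>\<theta> \<ge> 0\<close> abs_le_square_iff[of "lastc x - lastc y" \<theta>] by simp
qed

lemma ratio_pos: "\<theta> > 0 \<Longrightarrow> 0 < ratio \<theta> s"
  by (simp add: ratio_def add_nonneg_pos)

lemma ratio_le_1: "\<theta> > 0 \<Longrightarrow> ratio \<theta> s \<le> 1"
  unfolding ratio_def by (intro power_le_one) (auto simp: field_simps)

text \<open>If \<open>\<bar>a\<bar> \<le> 2 * \<theta>\<close>, then \<open>ratio\<close> is at
  least 1/9 and the bound is trivial. Otherwise \<open>b\<close> is at least half of
  \<open>\<bar>a\<bar>\<close>, so the product hypothesis bounds \<open>1 - \<tau>\<close> by a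
  multiple of \<open>(\<theta> / a)\<^sup>2\<close>.\<close>

lemma ratio_upper:
  assumes "\<theta> > 0" "b \<ge> 0" "\<bar>\<bar>a\<bar> - b\<bar> \<le> \<theta>" "0 \<le> \<tau>" "\<tau> \<le> 1" "\<bar>a\<bar> * b * (1 - \<tau>) \<le> \<theta>\<^sup>2 / 2"
  shows "1 - \<tau> \<le> 9 * ratio \<theta> a"
proof -
  have "(1 - \<tau>) * (\<bar>a\<bar> + \<theta>)\<^sup>2 \<le> 9 * \<theta>\<^sup>2"
  proof (cases "\<bar>a\<bar> \<le> 2 * \<theta>")
    case True
    have "(1 - \<tau>) * (\<bar>a\<bar> + \<theta>)\<^sup>2 \<le> 1 * (3 * \<theta>)\<^sup>2"
      using True assms by (intro mult_mono power_mono) auto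
    then show ?thesis by simp
  next
    case False
    have "(1 - \<tau>) * (\<bar>a\<bar> + \<theta>)\<^sup>2 \<le> (1 - \<tau>) * ((3/2) * \<bar>a\<bar>)\<^sup>2"
      using False assms by (intro mult_left_mono power_mono) auto
    also have "\<dots> = 9/2 * (\<bar>a\<bar> * (\<bar>a\<bar>/2) * (1 - \<tau>))" by (simp add: power2_eq_square field_simps)
    also have "\<dots> \<le> 9/2 * (\<bar>a\<bar> * b * (1 - \<tau>))"
      using False assms by (intro mult_left_mono mult_right_mono) auto
    also have "\<dots> \<le> 9/2 * (\<theta>\<^sup>2/2)" using assms by (intro mult_left_mono) auto
    also have "\<dots> \<le> 9 * \<theta>\<^sup>2" by simp
    finally show ?thesis .
  qed
  moreover have "(\<bar>a\<bar> + \<theta>)\<^sup>2 > 0" using assms by (intro zero_less_power) auto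
  ultimately show ?thesis by (simp add: ratio_def power_divide pos_le_divide_eq)
qed

text \<open>As \<open>b \<le> \<bar>a\<bar> + \<theta>\<close>, dilating by
  \<open>1 - \<delta> * ratio\<close> costs the product of the two coordinates at most
  \<open>\<delta> * \<theta>\<^sup>2\<close>.\<close>

lemma ratio_lower:
  assumes "\<theta> > 0" "b \<ge> 0" "\<bar>\<bar>a\<bar> - b\<bar> \<le> \<theta>"
  shows "\<bar>a\<bar> * b * ratio \<theta> a \<le> \<theta>\<^sup>2"
proof -
  have "\<bar>a\<bar> * b \<le> (\<bar>a\<bar> + \<theta>) * (\<bar>a\<bar> + \<theta>)" using assms by (intro mult_mono) auto
  then have "\<bar>a\<bar> * b * \<theta>\<^sup>2 \<le> (\<bar>a\<bar> + \<theta>)\<^sup>2 * \<theta>\<^sup>2" by (intro mult_right_mono) (auto simp: power2_eq_square)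
  moreover have "(\<bar>a\<bar> + \<theta>)\<^sup>2 > 0" using assms by (intro zero_less_power) auto
  ultimately show ?thesis by (simp add: ratio_def power_divide pos_divide_le_eq mult.commute)
qed

text \<open>The undilated folded inner product is at most 1, the dilated one at least
  \<open>cos \<theta>\<close>. Their difference is a sum of nonnegative deficits, so each deficit is
  at most \<open>\<theta>\<^sup>2 / 2\<close> and \<open>ratio_upper\<close> applies coordinate by
  coordinate. The sign \<open>\<sigma>\<close> serves both halves of \<open>VBk\<close>.\<close>

lemma ecap_dilate:
  fixes x y :: "real^'n"
  assumes x: "x \<in> cball 0 1" and y: "y \<in> cball 0 1" and \<theta>: "0 < \<theta>" and \<sigma>: "\<bar>\<sigma>\<bar> = 1"
    and t: "\<And>i. \<bar>t i\<bar> \<le> 1" and s: "\<bar>s\<bar> \<le> 1"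
    and e: "((\<chi> i. y $ i * t i), (\<sigma> * lastc y) * s) \<in> ecap x \<theta>"
  shows "y \<in> foldcap x \<theta>" and "1 - \<bar>t i\<bar> \<le> 9 * ratio \<theta> (x $ i)" and "1 - \<bar>s\<bar> \<le> 9 * ratio \<theta> (lastc x)"
proof -
  let ?a = "lastc x" and ?b = "lastc y"
  have ab: "?a \<ge> 0" "?b \<ge> 0" using x y by auto
  have "cos \<theta> \<le> (\<Sum>i\<in>UNIV. x $ i * (y $ i * t i)) + ?a * (\<sigma> * ?b * s)"
    using e by (simp add: ecap_def inner_vec_def lastc_def)
  moreover have "(\<Sum>i\<in>UNIV. x $ i * (y $ i * t i)) \<le> (\<Sum>i\<in>UNIV. \<bar>x $ i * y $ i\<bar> * \<bar>t i\<bar>)"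
    by (intro sum_mono) (metis abs_ge_self abs_mult mult.assoc)
  moreover have "?a * (\<sigma> * ?b * s) \<le> ?a * ?b * \<bar>s\<bar>"
    using \<sigma> ab using abs_ge_self[of "?a * (\<sigma> * ?b * s)"] by (simp add: abs_mult mult_ac)
  ultimately have main: "cos \<theta> \<le> (\<Sum>i\<in>UNIV. \<bar>x $ i * y $ i\<bar> * \<bar>t i\<bar>) + ?a * ?b * \<bar>s\<bar>" by linarith
  have le1: "\<bar>x $ i * y $ i\<bar> * \<bar>t i\<bar> \<le> \<bar>x $ i * y $ i\<bar>" for i
    using t by (simp add: mult_left_le)
  have le2: "?a * ?b * \<bar>s\<bar> \<le> ?a * ?b" using ab s by (simp add: mult_left_le)
  show fc: "y \<in> foldcap x \<theta>"
  proof -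
    have "(\<Sum>i\<in>UNIV. \<bar>x $ i * y $ i\<bar> * \<bar>t i\<bar>) \<le> (\<Sum>i\<in>UNIV. \<bar>x $ i * y $ i\<bar>)"
      by (intro sum_mono le1)
    then show ?thesis unfolding foldcap_def using main y le2 by simp
  qed
  have "0 \<le> (\<Sum>i\<in>UNIV. (\<bar>x $ i\<bar> - \<bar>y $ i\<bar>)\<^sup>2) + (?a - ?b)\<^sup>2"
    by (intro add_nonneg_nonneg sum_nonneg) auto
  then have one: "(\<Sum>i\<in>UNIV. \<bar>x $ i * y $ i\<bar>) + ?a * ?b \<le> 1" using fold_dist_sq[OF x y] by argo
  have gap: "(\<Sum>i\<in>UNIV. \<bar>x $ i * y $ i\<bar> * (1 - \<bar>t i\<bar>)) + ?a * ?b * (1 - \<bar>s\<bar>) \<le> \<theta>\<^sup>2 / 2"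
    using main one one_minus_cos_le[of \<theta>] by (simp add: algebra_simps sum_subtractf)
  have nn: "0 \<le> \<bar>x $ i * y $ i\<bar> * (1 - \<bar>t i\<bar>)" for i using t by simp
  have nn2: "0 \<le> ?a * ?b * (1 - \<bar>s\<bar>)" using ab s by simp
  have "\<bar>x $ i * y $ i\<bar> * (1 - \<bar>t i\<bar>) \<le> (\<Sum>i\<in>UNIV. \<bar>x $ i * y $ i\<bar> * (1 - \<bar>t i\<bar>))"
    by (intro member_le_sum) (auto simp: nn)
  then have "\<bar>x $ i\<bar> * \<bar>y $ i\<bar> * (1 - \<bar>t i\<bar>) \<le> \<theta>\<^sup>2 / 2" using gap nn2 by (simp add: abs_mult)
  then show "1 - \<bar>t i\<bar> \<le> 9 * ratio \<theta> (x $ i)"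
    using \<theta> t foldcap_close(1)[OF x fc, of i] by (intro ratio_upper[where b="\<bar>y $ i\<bar>"]) auto
  have "0 \<le> (\<Sum>i\<in>UNIV. \<bar>x $ i * y $ i\<bar> * (1 - \<bar>t i\<bar>))" by (intro sum_nonneg) (auto simp: nn)
  then have "\<bar>?a\<bar> * ?b * (1 - \<bar>s\<bar>) \<le> \<theta>\<^sup>2 / 2" using gap ab by simp
  then show "1 - \<bar>s\<bar> \<le> 9 * ratio \<theta> (lastc x)"
    using \<theta> s foldcap_close(2)[OF x fc] ab by (intro ratio_upper[where b="?b"]) auto
qed

text \<open>Each of the \<open>d+1\<close> products loses at most
  \<open>\<delta> * \<theta>\<^sup>2\<close>, and the total fits into the gap of
  \<open>cos_half_gap\<close>. Being in the octant of \<open>x\<close> makes all products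
  nonnegative, so the folded inner product is the true one.\<close>

lemma dilate_ecap:
  fixes x y :: "real^'n" and \<delta> s :: real
  assumes x: "x \<in> cball 0 1" and y: "y \<in> octcap x (\<theta>/2)" and \<theta>: "0 < \<theta>" "\<theta> \<le> pi"
    and \<delta>: "0 < \<delta>" "\<delta> * (real CARD('n) + 1) \<le> 1/32"
    and t: "\<And>i. t i \<in> {1 - \<delta> * ratio \<theta> (x $ i)..1}" and s: "s \<in> {1 - \<delta> * ratio \<theta> (lastc x)..1}"
  shows "((\<chi> i. y $ i * t i), lastc y * s) \<in> ecap x \<theta>"
proof -
  let ?a = "lastc x" and ?b = "lastc y"
  have yb: "y \<in> cball 0 1" and fc: "y \<in> foldcap x (\<theta>/2)" and oct: "\<And>i. 0 \<le> x $ i * y $ i"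
    and c: "cos (\<theta>/2) \<le> (\<Sum>i\<in>UNIV. x $ i * y $ i) + ?a * ?b"
    using y by (auto simp: foldcap_def octcap_def)
  have ab: "?a \<ge> 0" "?b \<ge> 0" using x yb by auto
  have "\<delta> * 1 \<le> \<delta> * (real CARD('n) + 1)" using \<delta> by (intro mult_left_mono) auto
  then have \<delta>1: "\<delta> \<le> 1" using \<delta> by linarith
  have small: "0 \<le> 1 - \<delta> * ratio \<theta> r" for r
    using mult_mono[OF \<delta>1, of "ratio \<theta> r" 1] ratio_pos[OF \<theta>(1), of r] ratio_le_1[OF \<theta>(1), of r] by simp
  have t01: "0 \<le> t i" "t i \<le> 1" for i using t[of i] small[of "x $ i"] by auto
  have s01: "0 \<le> s" "s \<le> 1" using s small[of ?a] by auto
  have ti: "x $ i * y $ i - \<delta> * \<theta>\<^sup>2 \<le> x $ i * (y $ i * t i)" for i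
  proof -
    have "\<bar>x $ i\<bar> * \<bar>y $ i\<bar> * ratio \<theta> (x $ i) \<le> \<theta>\<^sup>2"
      using \<theta> foldcap_close(1)[OF x fc, of i] by (intro ratio_lower) auto
    then have r: "x $ i * y $ i * ratio \<theta> (x $ i) \<le> \<theta>\<^sup>2"
      using oct[of i] by (simp add: abs_mult[symmetric])
    have "x $ i * y $ i * (1 - t i) \<le> x $ i * y $ i * (\<delta> * ratio \<theta> (x $ i))"
      using t[of i] oct[of i] by (intro mult_left_mono) auto
    also have "\<dots> = \<delta> * (x $ i * y $ i * ratio \<theta> (x $ i))" by simp
    also have "\<dots> \<le> \<delta> * \<theta>\<^sup>2" using r \<delta> by (intro mult_left_mono) auto
    finally show ?thesis by (simp add: algebra_simps)
  qed
  have si: "?a * ?b - \<delta> * \<theta>\<^sup>2 \<le> ?a * (?b * s)"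
  proof -
    have r: "?a * ?b * ratio \<theta> ?a \<le> \<theta>\<^sup>2"
      using ratio_lower[of \<theta> ?b ?a] \<theta> foldcap_close(2)[OF x fc] ab by simp
    have "?a * ?b * (1 - s) \<le> ?a * ?b * (\<delta> * ratio \<theta> ?a)"
      using s ab by (intro mult_left_mono) auto
    also have "\<dots> = \<delta> * (?a * ?b * ratio \<theta> ?a)" by simp
    also have "\<dots> \<le> \<delta> * \<theta>\<^sup>2" using r \<delta> by (intro mult_left_mono) auto
    finally show ?thesis by (simp add: algebra_simps)
  qed
  have "(\<Sum>i\<in>UNIV. x $ i * y $ i - \<delta> * \<theta>\<^sup>2) \<le> (\<Sum>i\<in>UNIV. x $ i * (y $ i * t i))"
    by (intro sum_mono ti)
  then have "(\<Sum>i\<in>UNIV. x $ i * y $ i) - CARD('n) * (\<delta> * \<theta>\<^sup>2) \<le> (\<Sum>i\<in>UNIV. x $ i * (y $ i * t i))"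
    by (simp add: sum_subtractf)
  then have "cos (\<theta>/2) - (real CARD('n) + 1) * (\<delta> * \<theta>\<^sup>2) \<le> (\<Sum>i\<in>UNIV. x $ i * (y $ i * t i)) + ?a * (?b * s)"
    using si c by (simp add: algebra_simps)
  moreover have "(real CARD('n) + 1) * (\<delta> * \<theta>\<^sup>2) \<le> \<theta>\<^sup>2 / 32"
    using mult_right_mono[OF \<delta>(2), of "\<theta>\<^sup>2"] by (simp add: algebra_simps)
  ultimately have inner: "cos \<theta> \<le> (\<Sum>i\<in>UNIV. x $ i * (y $ i * t i)) + ?a * (?b * s)"
    using cos_half_gap[OF \<theta>] by linarith
  have sq: "(y $ i * t i)\<^sup>2 \<le> (y $ i)\<^sup>2" for i
    using t01[of i] by (simp add: power_mult_distrib mult_left_le power_le_one)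
  have "(norm (\<chi> i. y $ i * t i))\<^sup>2 \<le> (norm y)\<^sup>2"
    using sq by (simp add: norm_vec_sq sum_mono)
  moreover have "(?b * s)\<^sup>2 \<le> ?b\<^sup>2" using s01 by (simp add: power_mult_distrib mult_left_le power_le_one)
  ultimately have "(norm (\<chi> i. y $ i * t i))\<^sup>2 + (?b * s)\<^sup>2 \<le> 1" using lastc_sq[OF yb] by argo
  then have "norm ((\<chi> i. y $ i * t i), ?b * s) \<le> 1" by (simp add: norm_Pair)
  then show ?thesis using inner ab s01
    by (simp add: ecap_def inner_vec_def lastc_def[symmetric])
qed

section \<open>Two-sided bounds for the averaged intertwining operator on caps\<close>

lemma capfactor_nonneg: "0 \<le> capfactor kap kapd x \<theta>"
  by (auto simp: capfactor_def intro!: mult_nonneg_nonneg prod_nonneg)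

lemma ecap_borel [measurable]: "ecap x \<theta> \<in> sets borel"
proof -
  let ?E = "{p. norm p \<le> 1} \<inter> {p. cos \<theta> \<le> inner x (fst p) + sqrt (1 - (norm x)\<^sup>2) * snd p} \<inter> {p. 0 \<le> snd p}"
  have "ecap x \<theta> = ?E" by (auto simp: ecap_def)
  moreover have "?E \<in> sets borel"
    by (intro borel_closed closed_Int closed_Collect_le continuous_intros)
  ultimately show ?thesis by (simp only:)
qed

text \<open>\<open>ecap_dilate\<close> confines the dilation parameters to a product of collars,
  whose masses multiply to \<open>capfactor\<close> up to a constant.\<close>

lemma VBk_ecap_le:
  fixes kap :: "real^'n" and kapd :: real
  assumes kap: "\<And>i. kap $ i \<ge> 0" and kapd: "kapd \<ge> 0"
  shows "\<exists>C>0. \<forall>x\<in>cball 0 1. \<forall>\<theta>>0. \<forall>y\<in>cball 0 1.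
    VBk kap kapd (indicator (ecap x \<theta>)) (liftY y) \<le> C * capfactor kap kapd x \<theta> * indicator (foldcap x \<theta>) y"
proof -
  \<comment> \<open>The constants are chosen as a function of the exponent, so that a product over
    the coordinates can be formed.\<close>
  obtain C where C: "\<And>k u. k \<ge> 0 \<Longrightarrow> u > 0 \<Longrightarrow> measure (nuk k) {t. 1 - \<bar>t\<bar> \<le> u} \<le> C k * u powr k"
    "\<And>k. k \<ge> 0 \<Longrightarrow> C k > 0"
  proof -
    have "\<forall>k. \<exists>C. k \<ge> 0 \<longrightarrow> C > 0 \<and> (\<forall>u>0. measure (nuk k) {t. 1 - \<bar>t\<bar> \<le> u} \<le> C * u powr k)"
      using nuk_collar_upper by blast
    from choice[OF this] show ?thesis using that by blast
  qed
  define D where "D = 2 ^ (CARD('n) + 1) * ((\<Prod>i\<in>UNIV. C (kap $ i) * 9 powr (kap $ i)) * (C kapd * 9 powr kapd))"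
  have "D > 0" unfolding D_def using C(2) kap kapd by (intro mult_pos_pos prod_pos) auto
  moreover have "VBk kap kapd (indicator (ecap x \<theta>)) (liftY y) \<le> D * capfactor kap kapd x \<theta> * indicator (foldcap x \<theta>) y"
    if x: "x \<in> cball 0 1" and \<theta>: "\<theta> > 0" and y: "y \<in> cball 0 1" for x y \<theta>
  proof -
    \<comment> \<open>Membership of \<open>y\<close> is part of the condition: off the folded cap
      the box is empty, which yields the indicator in the claim.\<close>
    define U where "U r = {t. y \<in> foldcap x \<theta> \<and> 1 - \<bar>t\<bar> \<le> 9 * ratio \<theta> r}" for r
    have [measurable]: "U r \<in> sets borel" for r unfolding U_def by measurable
    have one: "measure (nuk k) (U r) \<le> C k * 9 powr k * ratio \<theta> r powr k * indicator (foldcap x \<theta>) y" if "k \<ge> 0" for k r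
    proof (cases "y \<in> foldcap x \<theta>")
      case True
      have "measure (nuk k) (U r) \<le> C k * (9 * ratio \<theta> r) powr k"
      proof -
        have "U r = {t. 1 - \<bar>t\<bar> \<le> 9 * ratio \<theta> r}" using True by (simp only: U_def simp_thms)
        moreover have "0 < 9 * ratio \<theta> r" using ratio_pos[OF \<theta>] by simp
        ultimately show ?thesis by (simp only: C(1)[OF that])
      qed
      also have "(9 * ratio \<theta> r) powr k = 9 powr k * ratio \<theta> r powr k"
        by (rule powr_mult)
      finally show ?thesis using True by (simp add: mult.assoc)
    qed (simp add: U_def)
    have V: "Vk kap kapd (indicator (ecap x \<theta>)) (y, \<sigma> * lastc y)
        \<le> D * capfactor kap kapd x \<theta> * indicator (foldcap x \<theta>) y" if \<sigma>: "\<bar>\<sigma>\<bar> = 1" for \<sigma>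
    proof -
      have "Vk kap kapd (indicator (ecap x \<theta>)) (y, \<sigma> * lastc y)
          \<le> 2 ^ (CARD('n) + 1) * ((\<Prod>i\<in>UNIV. measure (nuk (kap $ i)) (U (x $ i))) * measure (nuk kapd) (U (lastc x)))"
      proof (intro Vk_indicator_le[OF kap kapd])
        fix t :: "'n \<Rightarrow> real" and s :: real
        assume t: "\<And>i. \<bar>t i\<bar> \<le> 1" "\<bar>s\<bar> \<le> 1"
          and "(\<chi> i. fst (y, \<sigma> * lastc y) $ i * t i, snd (y, \<sigma> * lastc y) * s) \<in> ecap x \<theta>"
        then have e: "(\<chi> i. y $ i * t i, \<sigma> * lastc y * s) \<in> ecap x \<theta>" by simp
        show "(\<forall>i. t i \<in> U (x $ i)) \<and> s \<in> U (lastc x)"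
          unfolding U_def using ecap_dilate[OF x y \<theta> \<sigma> t e] by blast
      qed auto
      \<comment> \<open>The indicator is kept on the last factor only, so that it occurs once in the
        product.\<close>
      also have "\<dots> \<le> 2 ^ (CARD('n) + 1) * ((\<Prod>i\<in>UNIV. C (kap $ i) * 9 powr (kap $ i) * ratio \<theta> (x $ i) powr (kap $ i))
          * (C kapd * 9 powr kapd * ratio \<theta> (lastc x) powr kapd * indicator (foldcap x \<theta>) y))"
      proof (intro mult_left_mono mult_mono prod_mono conjI one kapd)
        fix i
        show "measure (nuk (kap $ i)) (U (x $ i)) \<le> C (kap $ i) * 9 powr (kap $ i) * ratio \<theta> (x $ i) powr (kap $ i)"
          using one[OF kap, of i "x $ i"] C(2)[OF kap, of i]
          by (cases "y \<in> foldcap x \<theta>") (auto simp: U_def less_imp_le)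
      qed (simp_all add: less_imp_le[OF C(2)[OF kap]] less_imp_le[OF C(2)[OF kapd]] prod_nonneg)
      also have "\<dots> = D * capfactor kap kapd x \<theta> * indicator (foldcap x \<theta>) y"
        by (simp add: D_def capfactor_def prod.distrib)
      finally show ?thesis .
    qed
    show ?thesis using V[of 1] V[of "-1"] by (simp add: VBk_def liftY_def lastc_def[symmetric])
  qed
  ultimately show ?thesis by blast
qed

text \<open>Only the half of \<open>VBk\<close> with the positive last coordinate is used; the other
  half is nonnegative. This accounts for the division by 2 in \<open>D\<close>.\<close>

lemma VBk_ecap_ge:
  fixes kap :: "real^'n" and kapd :: real
  assumes kap: "\<And>i. kap $ i \<ge> 0" and kapd: "kapd \<ge> 0"
  shows "\<exists>c>0. \<forall>x\<in>cball 0 1. \<forall>\<theta>\<in>{0<..pi}. \<forall>y\<in>octcap x (\<theta>/2).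
    c * capfactor kap kapd x \<theta> \<le> VBk kap kapd (indicator (ecap x \<theta>)) (liftY y)"
proof -
  obtain c where c: "\<And>k u. k \<ge> 0 \<Longrightarrow> 0 < u \<Longrightarrow> u \<le> 1 \<Longrightarrow> c k * u powr k \<le> measure (nuk k) {1-u..1}"
    "\<And>k. k \<ge> 0 \<Longrightarrow> c k > 0"
  proof -
    have "\<forall>k. \<exists>c. k \<ge> 0 \<longrightarrow> c > 0 \<and> (\<forall>u. 0 < u \<and> u \<le> 1 \<longrightarrow> c * u powr k \<le> measure (nuk k) {1-u..1})"
      using nuk_collar_lower by blast
    from choice[OF this] show ?thesis using that by blast
  qed
  \<comment> \<open>Chosen so that \<open>d+1\<close> losses of
    \<open>\<delta> * \<theta>\<^sup>2\<close> add up to exactly the gap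
    \<open>\<theta>\<^sup>2 / 32\<close>.\<close>
  define \<delta> where "\<delta> = 1 / (32 * (real CARD('n) + 1))"
  have \<delta>: "0 < \<delta>" "\<delta> * (real CARD('n) + 1) \<le> 1/32" "\<delta> \<le> 1"
    by (auto simp: \<delta>_def field_simps)
  define D where "D = (\<Prod>i\<in>UNIV. c (kap $ i) * \<delta> powr (kap $ i)) * (c kapd * \<delta> powr kapd) / 2"
  have "D > 0" unfolding D_def using c(2) \<delta> kap kapd by (intro mult_pos_pos divide_pos_pos prod_pos) auto
  moreover have "D * capfactor kap kapd x \<theta> \<le> VBk kap kapd (indicator (ecap x \<theta>)) (liftY y)"
    if x: "x \<in> cball 0 1" and \<theta>: "\<theta> \<in> {0<..pi}" and y: "y \<in> octcap x (\<theta>/2)" for x y \<theta>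
  proof -
    have \<theta>': "0 < \<theta>" "\<theta> \<le> pi" using \<theta> by auto
    define U where "U r = {1 - \<delta> * ratio \<theta> r..1}" for r
    have ur: "0 < \<delta> * ratio \<theta> r" "\<delta> * ratio \<theta> r \<le> 1" for r
      using \<delta> ratio_pos[OF \<theta>'(1), of r] mult_mono[OF \<delta>(3) ratio_le_1[OF \<theta>'(1), of r]] by auto
    have one: "c k * \<delta> powr k * ratio \<theta> r powr k \<le> measure (nuk k) (U r)" if "k \<ge> 0" for k r
      using c(1)[OF that ur] \<delta> ratio_pos[OF \<theta>'(1), of r] by (simp add: powr_mult U_def mult.assoc)
    have "2 * (D * capfactor kap kapd x \<theta>)
        = (\<Prod>i\<in>UNIV. c (kap $ i) * \<delta> powr (kap $ i) * ratio \<theta> (x $ i) powr (kap $ i))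
          * (c kapd * \<delta> powr kapd * ratio \<theta> (lastc x) powr kapd)"
      by (simp add: D_def capfactor_def prod.distrib)
    also have "\<dots> \<le> (\<Prod>i\<in>UNIV. measure (nuk (kap $ i)) (U (x $ i))) * measure (nuk kapd) (U (lastc x))"
      using c(2)[OF kap] c(2)[OF kapd]
      by (intro mult_mono prod_mono conjI one kap kapd)
        (auto intro!: prod_nonneg mult_nonneg_nonneg simp: less_imp_le)
    also have "\<dots> \<le> Vk kap kapd (indicator (ecap x \<theta>)) (y, lastc y)"
    proof (intro Vk_indicator_ge[OF kap kapd])
      show "U r \<subseteq> {0..1}" for r using ur[of r] by (auto simp: U_def)
      then show "U (lastc x) \<subseteq> {0..1}" .
      fix t :: "'n \<Rightarrow> real" and s
      assume "\<And>i. t i \<in> U (x $ i)" "s \<in> U (lastc x)"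
      then show "(\<chi> i. fst (y, lastc y) $ i * t i, snd (y, lastc y) * s) \<in> ecap x \<theta>"
        using dilate_ecap[OF x y \<theta>' \<delta>(1,2)] by (simp add: U_def)
    qed (auto simp: U_def)
    also have "\<dots> \<le> 2 * VBk kap kapd (indicator (ecap x \<theta>)) (liftY y)"
      using Vk_indicator_nonneg[OF kap kapd, of "ecap x \<theta>" "(y, - lastc y)"]
      by (simp add: VBk_def liftY_def lastc_def[symmetric])
    finally show ?thesis by simp
  qed
  ultimately show ?thesis by blast
qed

section \<open>The weighted measure in cone coordinates\<close>

lemma nn_integral_lborel_affine:
  fixes F :: "'a::euclidean_space \<Rightarrow> ennreal"
  assumes [measurable]: "F \<in> borel_measurable borel" and c: "c \<noteq> 0"
  shows "(\<integral>\<^sup>+x. F x \<partial>lborel) = ennreal (\<bar>c\<bar> ^ DIM('a)) * (\<integral>\<^sup>+x. F (t + c *\<^sub>R x) \<partial>lborel)"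
  by (subst lborel_affine[OF c, of t])
    (simp add: nn_integral_density nn_integral_distr nn_integral_cmult)

lemma measurable_vec_component [measurable]: "(\<lambda>x::real^'n. x $ i) \<in> borel_measurable borel"
  by (intro borel_measurable_continuous_onI continuous_intros)

text \<open>Keeping the norm between 1/2 and 1 makes the normalisation in
  \<open>central_proj\<close> cost at most a factor 2.\<close>

definition shell :: "((real^'n) \<times> real) set" where
  "shell = {z. 0 < snd z \<and> 1/2 \<le> norm z \<and> norm z \<le> 1}"

text \<open>Radial projection to the upper hemisphere (for points of \<open>shell\<close>), followed
  by forgetting the last coordinate.\<close>

definition central_proj :: "(real^'n) \<times> real \<Rightarrow> real^'n" where
  "central_proj z = fst z /\<^sub>R norm z"

lemma measurable_central_proj [measurable]: "central_proj \<in> borel_measurable borel"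
proof -
  have [measurable]: "(fst :: (real^'n) \<times> real \<Rightarrow> _) \<in> borel_measurable borel"
    by (intro borel_measurable_continuous_onI continuous_intros)
  show ?thesis unfolding central_proj_def by measurable
qed

lemma shell_borel [measurable]: "shell \<in> sets borel"
proof -
  have "shell = {z. 0 < snd z} \<inter> {z. 1/2 \<le> norm z} \<inter> {z. norm z \<le> 1}"
    by (auto simp: shell_def)
  also have "\<dots> \<in> sets borel"
    by (intro sets.Int borel_open borel_closed open_Collect_less closed_Collect_le continuous_intros)
  finally show ?thesis .
qed

text \<open>Substitute \<open>r = sqrt (\<parallel>v\<parallel>\<^sup>2 + s\<^sup>2)\<close> for the height \<open>s\<close>.\<close>
lemma nn_integral_height_to_radius:
  fixes v :: "real^'n" and g :: "real^'n \<Rightarrow> ennreal"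
  assumes [measurable]: "g \<in> borel_measurable borel" and v: "v \<noteq> 0"
  shows "(\<integral>\<^sup>+s. g (central_proj (v, s)) * indicator shell (v, s) \<partial>lborel)
    = (\<integral>\<^sup>+r. g (v /\<^sub>R r) * indicator {r. norm v < r \<and> 1/2 \<le> r \<and> r \<le> 1} r
        * ennreal (r / sqrt (r\<^sup>2 - (norm v)\<^sup>2)) \<partial>lborel)"
proof -
  let ?\<phi> = "\<lambda>s. sqrt ((norm v)\<^sup>2 + s\<^sup>2)"
  let ?f = "\<lambda>r. g (v /\<^sub>R r) * indicator {r. norm v < r \<and> 1/2 \<le> r \<and> r \<le> 1} r
        * ennreal (r / sqrt (r\<^sup>2 - (norm v)\<^sup>2))"
  have pos: "(norm v)\<^sup>2 + s\<^sup>2 > 0" for s using v by (simp add: add_pos_nonneg)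
  \<comment> \<open>The substitution can be confined to heights in [0,1]: a point of the shell has
    height at most 1, and radii up to 1 do not exceed the radius at height 1.\<close>
  have sub: "(\<integral>\<^sup>+r. ?f r * indicator {?\<phi> 0..?\<phi> 1} r \<partial>lborel)
     = (\<integral>\<^sup>+s. ?f (?\<phi> s) * ennreal (s / ?\<phi> s) * indicator {0..1} s \<partial>lborel)"
  proof (rule nn_integral_substitution_aux)
    show "(?\<phi> has_real_derivative s / ?\<phi> s) (at s)" for s
      using pos[of s] by (auto intro!: derivative_eq_intros simp: field_simps)
    show "continuous_on {0..1} (\<lambda>s. s / ?\<phi> s)"
      using pos by (intro continuous_intros) (metis less_irrefl real_sqrt_eq_0_iff)
  qed (use pos in \<open>auto simp: less_imp_le\<close>)
  have "(\<integral>\<^sup>+s. g (central_proj (v, s)) * indicator shell (v, s) \<partial>lborel)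
      = (\<integral>\<^sup>+s. ?f (?\<phi> s) * ennreal (s / ?\<phi> s) * indicator {0..1} s \<partial>lborel)"
  proof (intro nn_integral_cong)
    fix s :: real
    show "g (central_proj (v, s)) * indicator shell (v, s) = ?f (?\<phi> s) * ennreal (s / ?\<phi> s) * indicator {0..1} s"
    proof (cases "0 < s \<and> ?\<phi> s \<le> 1")
      case True
      have "s \<le> ?\<phi> s" by (rule real_le_rsqrt) simp
      then have s: "0 < s" "s \<le> 1" using True by linarith+
      have nv: "norm v < ?\<phi> s" using s by (intro real_less_rsqrt) auto
      have sq: "sqrt ((?\<phi> s)\<^sup>2 - (norm v)\<^sup>2) = s" using s by simp
      have "ennreal (?\<phi> s / s) * ennreal (s / ?\<phi> s) = 1"
        using s pos[of s] by (subst ennreal_mult[symmetric]) (auto simp: less_imp_le)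
      then show ?thesis using s True nv unfolding sq
        by (simp add: central_proj_def shell_def norm_Pair indicator_def mult.assoc)
    next
      case False
      then show ?thesis by (cases "s = 0") (auto simp: shell_def norm_Pair indicator_def)
    qed
  qed
  also have "\<dots> = (\<integral>\<^sup>+r. ?f r * indicator {?\<phi> 0..?\<phi> 1} r \<partial>lborel)" by (rule sub[symmetric])
  also have "\<dots> = (\<integral>\<^sup>+r. ?f r \<partial>lborel)"
  proof (intro nn_integral_cong)
    fix r :: real
    have "1 \<le> ?\<phi> 1" by simp
    then have "r \<le> 1 \<Longrightarrow> r \<le> ?\<phi> 1" by linarith
    then show "?f r * indicator {?\<phi> 0..?\<phi> 1} r = ?f r" by (auto simp: indicator_def)
  qed
  finally show ?thesis .
qed

text \<open>Substitute \<open>v = r *\<^sub>R y\<close>; the quotient with the root is homogeneous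
  of degree 0, so the radius separates off as the Jacobian alone.\<close>

lemma nn_integral_slice_scale:
  fixes g :: "real^'n \<Rightarrow> ennreal"
  assumes [measurable]: "g \<in> borel_measurable borel" and r: "r > 0"
  shows "(\<integral>\<^sup>+v. g (v /\<^sub>R r) * indicator {v. norm v < r} v * ennreal (r / sqrt (r\<^sup>2 - (norm v)\<^sup>2)) \<partial>lborel)
    = ennreal (r ^ CARD('n)) * (\<integral>\<^sup>+y. g y * indicator (ball 0 1) y * ennreal (1 / sqrt (1 - (norm y)\<^sup>2)) \<partial>lborel)"
proof -
  have sq: "r / sqrt (r\<^sup>2 - (r * a)\<^sup>2) = 1 / sqrt (1 - a\<^sup>2)" for a
  proof -
    have "r\<^sup>2 - (r * a)\<^sup>2 = r\<^sup>2 * (1 - a\<^sup>2)" by algebra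
    then have "sqrt (r\<^sup>2 - (r * a)\<^sup>2) = r * sqrt (1 - a\<^sup>2)" using r by (simp add: real_sqrt_mult)
    then show ?thesis using r by simp
  qed
  have "(\<integral>\<^sup>+v. g (v /\<^sub>R r) * indicator {v. norm v < r} v * ennreal (r / sqrt (r\<^sup>2 - (norm v)\<^sup>2)) \<partial>lborel)
    = ennreal (\<bar>r\<bar> ^ DIM(real^'n)) * (\<integral>\<^sup>+y. g ((0 + r *\<^sub>R y) /\<^sub>R r) * indicator {v. norm v < r} (0 + r *\<^sub>R y)
        * ennreal (r / sqrt (r\<^sup>2 - (norm (0 + r *\<^sub>R y))\<^sup>2)) \<partial>lborel)"
    using r by (intro nn_integral_lborel_affine) auto
  also have "\<dots> = ennreal (r ^ CARD('n)) * (\<integral>\<^sup>+y. g y * indicator (ball 0 1) y * ennreal (1 / sqrt (1 - (norm y)\<^sup>2)) \<partial>lborel)"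
    using r by (auto intro!: arg_cong2[where f="(*)"] nn_integral_cong simp: sq indicator_def)
  finally show ?thesis .
qed

text \<open>The factor \<open>1 / sqrt (1 - (norm y)\<^sup>2)\<close> is the density of
  hemispherical surface measure projected to the ball. Hence integrating against it is, up to a
  radial constant, Lebesgue integration of a radially constant function over the shell.\<close>

lemma cone_formula:
  obtains K :: ennreal where "K \<noteq> 0" "K \<noteq> \<infinity>"
    "\<And>g :: real^'n \<Rightarrow> ennreal. g \<in> borel_measurable borel \<Longrightarrow>
      (\<integral>\<^sup>+z. g (central_proj z) * indicator shell z \<partial>lborel)
      = K * (\<integral>\<^sup>+y. g y * indicator (ball 0 1) y * ennreal (1 / sqrt (1 - (norm y)\<^sup>2)) \<partial>lborel)"
proof -
  define K where "K = (\<integral>\<^sup>+r. indicator {1/2..1::real} r * ennreal (r ^ CARD('n)) \<partial>lborel)"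
  have "K \<le> (\<integral>\<^sup>+r. indicator {1/2..1::real} r \<partial>lborel)"
    unfolding K_def by (intro nn_integral_mono) (auto simp: indicator_def power_le_one)
  then have K1: "K \<noteq> \<infinity>" by (auto simp: top_unique)
  have "0 < ennreal ((1/2) ^ CARD('n)) * ennreal (1/2)"
    by (simp add: ennreal_zero_less_mult_iff ennreal_inverse_positive)
  also have "\<dots> = (\<integral>\<^sup>+r. ennreal ((1/2) ^ CARD('n)) * indicator {1/2..1::real} r \<partial>lborel)"
    by (subst nn_integral_cmult_indicator) auto
  also have "\<dots> \<le> K"
    unfolding K_def by (intro nn_integral_mono) (auto simp: indicator_def intro!: ennreal_leI power_mono)
  finally have K0: "K \<noteq> 0" by auto
  show ?thesis
  proof (rule that[OF K0 K1])
    fix g :: "real^'n \<Rightarrow> ennreal" assume [measurable]: "g \<in> borel_measurable borel"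
    let ?I = "\<integral>\<^sup>+y. g y * indicator (ball 0 1) y * ennreal (1 / sqrt (1 - (norm y)\<^sup>2)) \<partial>lborel"
    let ?G = "\<lambda>(v::real^'n) r. g (v /\<^sub>R r) * indicator {r. norm v < r \<and> 1/2 \<le> r \<and> r \<le> 1} r
        * ennreal (r / sqrt (r\<^sup>2 - (norm v)\<^sup>2))"
    have [measurable]: "(\<lambda>z. g (central_proj z) * indicator shell z) \<in> borel_measurable (lborel \<Otimes>\<^sub>M lborel)"
      unfolding lborel_prod by measurable
    have "(\<integral>\<^sup>+z. g (central_proj z) * indicator shell z \<partial>lborel)
        = (\<integral>\<^sup>+v. \<integral>\<^sup>+s. g (central_proj (v, s)) * indicator shell (v, s) \<partial>lborel \<partial>lborel)"
      by (subst lborel_prod[symmetric], subst lborel.nn_integral_fst[symmetric]) auto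
    also have "\<dots> = (\<integral>\<^sup>+v. \<integral>\<^sup>+r. ?G v r \<partial>lborel \<partial>lborel)"
    \<comment> \<open>The change from height to radius requires a nonzero base point; the origin is
      a null set.\<close>
    proof (rule nn_integral_cong_AE)
      have "AE v in lborel. v \<noteq> (0::real^'n)" by (rule AE_lborel_singleton)
      then show "AE v in lborel. (\<integral>\<^sup>+s. g (central_proj (v, s)) * indicator shell (v, s) \<partial>lborel) = (\<integral>\<^sup>+r. ?G v r \<partial>lborel)"
        by eventually_elim (rule nn_integral_height_to_radius, auto)
    qed
    also have "\<dots> = (\<integral>\<^sup>+r. \<integral>\<^sup>+v. ?G v r \<partial>lborel \<partial>lborel)"
      by (rule lborel_pair.Fubini') (simp add: indicator_def, measurable)
    also have "\<dots> = (\<integral>\<^sup>+r. (indicator {1/2..1::real} r * ennreal (r ^ CARD('n))) * ?I \<partial>lborel)"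
    proof (intro nn_integral_cong)
      fix r :: real
      show "(\<integral>\<^sup>+v. ?G v r \<partial>lborel) = (indicator {1/2..1::real} r * ennreal (r ^ CARD('n))) * ?I"
      proof (cases "r \<in> {1/2..1}")
        case True
        then have "(\<integral>\<^sup>+v. ?G v r \<partial>lborel) = (\<integral>\<^sup>+v. g (v /\<^sub>R r) * indicator {v. norm v < r} v * ennreal (r / sqrt (r\<^sup>2 - (norm v)\<^sup>2)) \<partial>lborel)"
          by (intro nn_integral_cong) (auto simp: indicator_def)
        also have "\<dots> = ennreal (r ^ CARD('n)) * ?I"
          using True by (intro nn_integral_slice_scale) auto
        finally show ?thesis using True by simp
      next
        case False
        then have "?G v r = 0" for v by (auto simp: indicator_def)
        then show ?thesis using False by simp
      qed
    qed
    also have "\<dots> = K * ?I" unfolding K_def by (rule nn_integral_multc) measurable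
    finally show "(\<integral>\<^sup>+z. g (central_proj z) * indicator shell z \<partial>lborel) = K * ?I" .
  qed
qed

text \<open>\<open>WB\<close> without its singular factor. In terms of the lifted point it is the
  product of the powers \<open>2 * \<kappa>\<close> of the moduli of all \<open>d+1\<close>
  coordinates.\<close>

definition hweight :: "real^'n \<Rightarrow> real \<Rightarrow> real^'n \<Rightarrow> real" where
  "hweight kap kapd y = (\<Prod>i\<in>UNIV. if kap $ i = 0 then 1 else \<bar>y $ i\<bar> powr (2 * kap $ i))
     * (1 - (norm y)\<^sup>2) powr kapd"

lemma hweight_nonneg: "0 \<le> hweight kap kapd y"
  by (auto simp: hweight_def intro!: mult_nonneg_nonneg prod_nonneg)

lemma hweight_measurable [measurable]: "hweight kap kapd \<in> borel_measurable borel"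
  unfolding hweight_def by measurable

lemma WB_measurable [measurable]: "WB kap kapd \<in> borel_measurable borel"
  unfolding WB_def by measurable

lemma sets_muB [simp, measurable_cong]: "sets (muB kap kapd) = sets borel"
  by (simp add: muB_def)

lemma emeasure_muB:
  fixes S :: "(real^'n) set"
  assumes [measurable]: "S \<in> sets borel"
  shows "emeasure (muB kap kapd) S = (\<integral>\<^sup>+y. (ennreal (hweight kap kapd y) * indicator S y) * indicator (ball 0 1) y
    * ennreal (1 / sqrt (1 - (norm y)\<^sup>2)) \<partial>lborel)"
proof -
  \<comment> \<open>On the unit sphere \<open>WB\<close> is 0, as a power with base 0 is 0 for every
    exponent, so closed and open ball agree.\<close>
  have eq: "indicator (cball 0 1) y * WB kap kapd y = hweight kap kapd y * indicator (ball 0 1) y * (1 / sqrt (1 - (norm y)\<^sup>2))" for y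
  proof (cases "norm y < 1")
    case True
    then have "(norm y)\<^sup>2 < 1" by (simp add: power_less_one_iff)
    then show ?thesis using True by (simp add: WB_def hweight_def powr_diff powr_half_sqrt)
  next
    case False
    then show ?thesis by (cases "norm y = 1") (auto simp: WB_def)
  qed
  have [measurable]: "cball 0 1 \<in> sets (borel :: (real^'n) measure)" by simp
  have m: "(\<lambda>y. ennreal (indicator (cball 0 1) y * WB kap kapd y)) \<in> borel_measurable borel" by measurable
  have "emeasure (muB kap kapd) S = (\<integral>\<^sup>+y. ennreal (indicator (cball 0 1) y * WB kap kapd y) * indicator S y \<partial>lborel)"
    unfolding muB_def using assms m by (intro emeasure_density) simp_all
  also have "\<dots> = (\<integral>\<^sup>+y. (ennreal (hweight kap kapd y) * indicator S y) * indicator (ball 0 1) y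
      * ennreal (1 / sqrt (1 - (norm y)\<^sup>2)) \<partial>lborel)"
    unfolding eq by (intro nn_integral_cong) (auto simp: ennreal_mult'[symmetric] hweight_nonneg split: split_indicator)
  finally show ?thesis .
qed

lemma norm_pair_sq: "(norm z)\<^sup>2 = (norm (fst z))\<^sup>2 + (snd z)\<^sup>2" for z :: "(real^'n) \<times> real"
  by (cases z) (simp add: norm_Pair)

lemma central_proj_shell:
  assumes "z \<in> shell"
  shows "1 - (norm (central_proj z))\<^sup>2 = (snd z / norm z)\<^sup>2"
    and "lastc (central_proj z) = snd z / norm z"
    and "central_proj z \<in> cball 0 1"
proof -
  have z: "norm z > 0" "snd z > 0" using assms by (auto simp: shell_def)
  show eq: "1 - (norm (central_proj z))\<^sup>2 = (snd z / norm z)\<^sup>2"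
    using z norm_pair_sq[of z] by (simp add: central_proj_def power_mult_distrib divide_simps)
  show "lastc (central_proj z) = snd z / norm z"
    using z by (simp add: lastc_def eq)
  have "(norm (central_proj z))\<^sup>2 \<le> 1" using eq by (metis diff_ge_0_iff_ge zero_le_power2)
  then show "central_proj z \<in> cball 0 1" by (simp add: abs_square_le_1)
qed

lemma hweight_le_1:
  assumes "\<And>i. kap $ i \<ge> 0" "kapd \<ge> 0" "y \<in> cball 0 1"
  shows "hweight kap kapd y \<le> 1"
proof -
  have "\<bar>y $ i\<bar> \<le> 1" for i using component_le_norm_cart[of y i] assms(3) by simp
  then have "(\<Prod>i\<in>UNIV. if kap $ i = 0 then 1 else \<bar>y $ i\<bar> powr (2 * kap $ i)) \<le> 1"
    using assms by (intro prod_le_1) (auto intro!: powr_le1)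
  moreover have "(1 - (norm y)\<^sup>2) powr kapd \<le> 1"
    using assms by (intro powr_le1) (auto simp: abs_square_le_1)
  ultimately have "hweight kap kapd y \<le> 1 * 1" unfolding hweight_def by (intro mult_mono) auto
  then show ?thesis by simp
qed

lemma cone_measure:
  fixes kap :: "real^'n"
  obtains K :: ennreal where "K \<noteq> 0" "K \<noteq> \<infinity>"
    "\<And>S. S \<in> sets borel \<Longrightarrow> K * emeasure (muB kap kapd) S
      = (\<integral>\<^sup>+z. ennreal (hweight kap kapd (central_proj z)) * indicator S (central_proj z) * indicator shell z \<partial>lborel)"
proof -
  obtain K where K: "K \<noteq> 0" "K \<noteq> \<infinity>"
    "\<And>g :: real^'n \<Rightarrow> ennreal. g \<in> borel_measurable borel \<Longrightarrow>
      (\<integral>\<^sup>+z. g (central_proj z) * indicator shell z \<partial>lborel)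
      = K * (\<integral>\<^sup>+y. g y * indicator (ball 0 1) y * ennreal (1 / sqrt (1 - (norm y)\<^sup>2)) \<partial>lborel)"
    using cone_formula by blast
  show ?thesis
  proof (rule that[OF K(1,2)])
    fix S :: "(real^'n) set" assume [measurable]: "S \<in> sets borel"
    show "K * emeasure (muB kap kapd) S
      = (\<integral>\<^sup>+z. ennreal (hweight kap kapd (central_proj z)) * indicator S (central_proj z) * indicator shell z \<partial>lborel)"
      by (subst emeasure_muB, simp, rule K(3)[symmetric]) measurable
  qed
qed

text \<open>In shell coordinates the integrand is at most the indicator of the unit ball of
  dimension \<open>d+1\<close>.\<close>

lemma finite_muB:
  fixes kap :: "real^'n"
  assumes "\<And>i. kap $ i \<ge> 0" "kapd \<ge> 0"
  shows "emeasure (muB kap kapd) S \<noteq> \<infinity>"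
proof -
  obtain K where K: "K \<noteq> 0" "K \<noteq> \<infinity>"
    "\<And>S. S \<in> sets borel \<Longrightarrow> K * emeasure (muB kap kapd) S
      = (\<integral>\<^sup>+z. ennreal (hweight kap kapd (central_proj z)) * indicator S (central_proj z) * indicator shell z \<partial>lborel)"
    using cone_measure by blast
  have U: "UNIV \<in> sets (borel :: (real^'n) measure)" by simp
  have "K * emeasure (muB kap kapd) UNIV \<le> (\<integral>\<^sup>+z. indicator (cball 0 1) z \<partial>(lborel :: ((real^'n) \<times> real) measure))"
    unfolding K(3)[OF U]
  proof (intro nn_integral_mono)
    fix z :: "(real^'n) \<times> real"
    show "ennreal (hweight kap kapd (central_proj z)) * indicator UNIV (central_proj z) * indicator shell z \<le> indicator (cball 0 1) z"
    proof (cases "z \<in> shell")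
      case True
      then have "z \<in> cball 0 1" by (simp add: shell_def)
      then show ?thesis using True hweight_le_1[OF assms central_proj_shell(3)[OF True]] by (simp add: ennreal_le_1)
    qed simp
  qed
  also have "\<dots> < \<infinity>" using emeasure_bounded_finite[of "cball 0 1 :: ((real^'n) \<times> real) set"] by simp
  finally have "K * emeasure (muB kap kapd) UNIV < \<infinity>" .
  then have "emeasure (muB kap kapd) UNIV < \<infinity>"
    using K(1) by (auto simp: ennreal_mult_less_top)
  then show ?thesis
    using emeasure_mono[of S UNIV "muB kap kapd"] by (auto simp: top_unique)
qed

section \<open>Contraction towards the centre and doubling of octant caps\<close>

lemma foldcap_borel [measurable]: "foldcap x \<theta> \<in> sets borel"
proof -
  have "foldcap x \<theta> = cball 0 1 \<inter> {y. cos \<theta> \<le> (\<Sum>i\<in>UNIV. \<bar>x $ i * y $ i\<bar>) + lastc x * lastc y}"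
    by (auto simp: foldcap_def)
  also have "\<dots> \<in> sets borel" unfolding lastc_def
    by (intro borel_closed closed_Int closed_cball closed_Collect_le continuous_intros)
  finally show ?thesis .
qed

lemma octcap_borel [measurable]: "octcap x \<theta> \<in> sets borel"
proof -
  have "octcap x \<theta> = foldcap x \<theta> \<inter> (\<Inter>i. {y. 0 \<le> x $ i * y $ i})"
    by (auto simp: octcap_def)
  also have "\<dots> \<in> sets borel"
    by (intro sets.Int foldcap_borel borel_closed closed_INT ballI closed_Collect_le continuous_intros)
  finally show ?thesis .
qed

text \<open>The squared form of angle halving for \<open>w = 2/3 X + 1/3 z\<close>. Here
  \<open>n = norm z\<close>, \<open>p\<close> is the inner product of \<open>X\<close> and
  \<open>z\<close>, and \<open>C = cos \<theta>\<close>. Then \<open>(1 + C) / 2\<close> is the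
  square of \<open>cos (\<theta>/2)\<close>, while \<open>4 + 4 * p + n\<^sup>2\<close> is
  \<open>9 * (norm w)\<^sup>2\<close> and \<open>2 + p\<close> is three times the inner product of
  \<open>X\<close> and \<open>w\<close>.\<close>

lemma contraction_inequality:
  fixes p n C :: real
  assumes "0 \<le> p" "n * C \<le> p" "0 \<le> n" "n \<le> 1" "-1 \<le> C" "C \<le> 1"
  shows "(1 + C) / 2 * (4 + 4 * p + n\<^sup>2) \<le> (2 + p)\<^sup>2"
proof -
  have n2: "n\<^sup>2 \<le> 1" using assms by (simp add: power_le_one)
  have p4: "(1 - C) / 2 * 4 \<le> (1 - C) / 2 * (4 + 4 * p)" using assms by (intro mult_left_mono) auto
  have "0 \<le> (1 - C) / 2 * 4 + p\<^sup>2 - (1 + C) / 2 * n\<^sup>2"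
  proof (cases "C \<ge> 0")
    \<comment> \<open>Replacing \<open>p\<^sup>2\<close> by its lower bound
      \<open>n\<^sup>2 * C\<^sup>2\<close> leaves an expression with the factor
      \<open>(1 - C) / 2\<close> and cofactor \<open>4 - n\<^sup>2 * (1 + 2 * C)\<close>, at least
      1.\<close>
    case True
    have "n\<^sup>2 * C\<^sup>2 \<le> p\<^sup>2" using power_mono[OF assms(2), of 2] True assms by (simp add: power_mult_distrib)
    moreover have "n\<^sup>2 * (1 + 2 * C) \<le> 1 * 3" using n2 assms True by (intro mult_mono) auto
    then have "0 \<le> (1 - C) / 2 * (4 - n\<^sup>2 * (1 + 2 * C))" using assms by (intro mult_nonneg_nonneg) auto
    ultimately show ?thesis by (simp add: field_simps power2_eq_square)
  next
    case False
    have "(1 + C) / 2 * n\<^sup>2 \<le> 1/2 * 1" using False assms n2 by (intro mult_mono) auto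
    moreover have "2 \<le> (1 - C) / 2 * 4" using False by simp
    ultimately show ?thesis using zero_le_power2[of p] by linarith
  qed
  with p4 have "0 \<le> (1 - C) / 2 * (4 + 4 * p) + p\<^sup>2 - (1 + C) / 2 * n\<^sup>2" by linarith
  then show ?thesis by (simp add: field_simps power2_eq_square)
qed

lemma norm_sq_two_thirds:
  fixes a b :: "'a::real_inner"
  shows "(norm ((2/3) *\<^sub>R a + (1/3) *\<^sub>R b))\<^sup>2 = (4 * inner a a + 4 * inner a b + inner b b) / 9"
  by (simp add: power2_norm_eq_inner inner_add_left inner_add_right inner_commute[of b a] add_divide_distrib)

lemma norm_two_thirds_le:
  fixes a b :: "'a::real_normed_vector"
  shows "norm ((2/3) *\<^sub>R a + (1/3) *\<^sub>R b) \<le> 2/3 * norm a + 1/3 * norm b"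
  by (rule order_trans[OF norm_triangle_ineq]) simp

definition contract :: "real^'n \<Rightarrow> (real^'n) \<times> real \<Rightarrow> (real^'n) \<times> real" where
  "contract x z = (2/3) *\<^sub>R (x, lastc x) + (1/3) *\<^sub>R z"

text \<open>In the octant of \<open>x\<close> the two summands of each coordinate of
  \<open>contract x z\<close> do not cancel, so a third of the modulus for \<open>z\<close>
  survives. Normalising loses a further factor 2, since \<open>norm z\<close> is at least 1/2 and
  the norm of the image at most 1. This gives 6, and 36 for the squared last coordinate.\<close>

lemma contract_octcap:
  fixes x :: "real^'n"
  assumes x: "x \<in> cball 0 1" and z: "z \<in> shell" and y: "central_proj z \<in> octcap x \<theta>" and \<theta>: "\<theta> \<in> {0<..pi}"
  shows "contract x z \<in> shell" and "central_proj (contract x z) \<in> octcap x (\<theta>/2)"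
    and "\<bar>central_proj z $ i\<bar> / 6 \<le> \<bar>central_proj (contract x z) $ i\<bar>"
    and "(1 - (norm (central_proj z))\<^sup>2) / 36 \<le> 1 - (norm (central_proj (contract x z)))\<^sup>2"
proof -
  define n w p where "n = norm z" and "w = contract x z" and "p = inner x (fst z) + lastc x * snd z"
  have n: "1/2 \<le> n" "n \<le> 1" and sz: "0 < snd z" using z by (auto simp: shell_def n_def)
  have a: "0 \<le> lastc x" using x by simp
  have yi: "central_proj z $ i = fst z $ i / n" for i by (simp add: central_proj_def n_def divide_inverse_commute)
  have oct: "0 \<le> x $ i * fst z $ i" for i
    using y n yi[of i] by (auto simp: octcap_def zero_le_divide_iff dest!: spec[of _ i])
  have ip: "inner x (fst z) = (\<Sum>i\<in>UNIV. x $ i * fst z $ i)" by (simp add: inner_vec_def)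
  have p0: "0 \<le> p" unfolding p_def ip using oct a sz by (intro add_nonneg_nonneg sum_nonneg) auto
  have "cos \<theta> \<le> (\<Sum>i\<in>UNIV. \<bar>x $ i * central_proj z $ i\<bar>) + lastc x * lastc (central_proj z)"
    using y unfolding octcap_def foldcap_def by blast
  also have "\<dots> = p / n"
    using oct n by (simp add: yi central_proj_shell[OF z] p_def ip n_def[symmetric] add_divide_distrib sum_divide_distrib)
  finally have pn: "n * cos \<theta> \<le> p" using n by (simp add: pos_le_divide_eq mult.commute)
  have fw: "fst w $ i = 2/3 * x $ i + 1/3 * fst z $ i" for i by (simp add: w_def contract_def)
  have sw: "snd w = 2/3 * lastc x + 1/3 * snd z" by (simp add: w_def contract_def)
  have nX: "inner (x, lastc x) (x, lastc x) = 1"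
    using lastc_sq[OF x] by (simp only: power2_norm_eq_inner[symmetric]) (simp add: norm_Pair)
  have Xz: "inner (x, lastc x) z = p" by (cases z) (simp add: p_def)
  have wsq: "(norm w)\<^sup>2 = (4 + 4 * p + n\<^sup>2) / 9"
    unfolding w_def contract_def norm_sq_two_thirds nX Xz by (simp add: n_def power2_norm_eq_inner)
  have Xw: "inner (x, lastc x) w = (2 + p) / 3"
    unfolding w_def contract_def inner_add_right inner_scaleR_right nX Xz by simp
  \<comment> \<open>Nonnegativity of \<open>p\<close> keeps the image out of the small ball: its
    squared norm is at least 4/9.\<close>
  have "(1/2)\<^sup>2 \<le> (norm w)\<^sup>2" unfolding wsq using p0 zero_le_power2[of n] by (simp add: power2_eq_square)
  then have w1: "1/2 \<le> norm w" by (rule power2_le_imp_le) simp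
  have "norm w \<le> 2/3 * norm (x, lastc x) + 1/3 * norm z"
    unfolding w_def contract_def by (rule norm_two_thirds_le)
  moreover have "norm (x, lastc x) = 1" using nX by (simp only: norm_eq_sqrt_inner real_sqrt_one)
  ultimately have w2: "norm w \<le> 1" using n by (simp add: n_def)
  have sw0: "0 < snd w" using sw a sz by simp
  show wsh: "contract x z \<in> shell" using w1 w2 sw0 by (simp add: shell_def w_def)
  have wi: "central_proj w $ i = fst w $ i / norm w" for i by (simp add: central_proj_def divide_inverse_commute)
  have octw: "0 \<le> x $ i * fst w $ i" for i
    using oct[of i] by (simp add: fw algebra_simps)
  have c0: "0 \<le> cos (\<theta>/2)" using \<theta> by (intro cos_ge_zero) auto
  have "(cos (\<theta>/2))\<^sup>2 = (1 + cos \<theta>) / 2" using cos_double_cos[of "\<theta>/2"] by simp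
  then have "(cos (\<theta>/2) * norm w)\<^sup>2 = (1 + cos \<theta>) / 2 * (4 + 4 * p + n\<^sup>2) / 9"
    by (simp add: power_mult_distrib wsq)
  also have "\<dots> \<le> (2 + p)\<^sup>2 / 9"
    using contraction_inequality[OF p0 pn] n by simp
  also have "\<dots> = ((2 + p) / 3)\<^sup>2" by (simp add: power_divide)
  finally have "cos (\<theta>/2) * norm w \<le> (2 + p) / 3" by (rule power2_le_imp_le) (use p0 in simp)
  then have "cos (\<theta>/2) \<le> inner (x, lastc x) w / norm w"
    unfolding Xw using w1 by (intro mult_imp_le_div_pos) auto
  also have "\<dots> = (\<Sum>i\<in>UNIV. \<bar>x $ i * central_proj w $ i\<bar>) + lastc x * lastc (central_proj w)"
  proof -
    have "\<bar>x $ i * central_proj w $ i\<bar> = x $ i * fst w $ i / norm w" for i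
      using octw[of i] w1 by (simp add: wi)
    moreover have "lastc (central_proj w) = snd w / norm w"
      using central_proj_shell(2)[OF wsh] by (simp add: w_def)
    moreover have "inner (x, lastc x) w = (\<Sum>i\<in>UNIV. x $ i * fst w $ i) + lastc x * snd w"
      by (cases w) (simp add: inner_vec_def)
    ultimately show ?thesis by (simp add: add_divide_distrib sum_divide_distrib)
  qed
  finally show "central_proj (contract x z) \<in> octcap x (\<theta>/2)"
    using octw w1 central_proj_shell(3)[OF wsh] by (simp add: octcap_def foldcap_def wi w_def[symmetric])
  have shrink: "s / n / 6 \<le> t / norm w" if "0 \<le> s" "s / 3 \<le> t" for s t
  proof -
    have "s / n \<le> s / (1/2)" using that n by (intro divide_left_mono) auto
    then have "s / n / 6 \<le> t / 1" using that by simp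
    also have "t / 1 \<le> t / norm w" using that w1 w2 by (intro divide_left_mono) auto
    finally show ?thesis .
  qed
  have "\<bar>fst z $ i\<bar> / 3 \<le> \<bar>fst w $ i\<bar>"
    using oct[of i] by (auto simp: fw zero_le_mult_iff)
  then have "\<bar>fst z $ i\<bar> / n / 6 \<le> \<bar>fst w $ i\<bar> / norm w" by (intro shrink) auto
  then show "\<bar>central_proj z $ i\<bar> / 6 \<le> \<bar>central_proj (contract x z) $ i\<bar>"
    using n by (simp add: yi wi w_def[symmetric] abs_divide)
  have "snd z / n / 6 \<le> snd w / norm w" using sz sw a by (intro shrink) auto
  then have "(snd z / n / 6)\<^sup>2 \<le> (snd w / norm w)\<^sup>2" using sz n by (intro power_mono) auto
  then show "(1 - (norm (central_proj z))\<^sup>2) / 36 \<le> 1 - (norm (central_proj (contract x z)))\<^sup>2"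
    unfolding central_proj_shell(1)[OF z] central_proj_shell(1)[OF wsh]
    by (simp add: w_def n_def power_divide)
qed

text \<open>The contraction sends the part of the shell over the cap into the part over the half cap
  and decreases the weight by at most the factor \<open>C\<close>. Changing variables costs
  \<open>3 ^ (d+1)\<close>, and the constant \<open>K\<close> of the cone formula cancels because it
  is neither 0 nor infinite.\<close>

lemma octcap_doubling:
  fixes kap :: "real^'n"
  assumes kap: "\<And>i. kap $ i \<ge> 0" and kapd: "kapd \<ge> 0"
  shows "\<exists>D>0. \<forall>x\<in>cball 0 1. \<forall>\<theta>\<in>{0<..pi}.
    emeasure (muB kap kapd) (octcap x \<theta>) \<le> ennreal D * emeasure (muB kap kapd) (octcap x (\<theta>/2))"
proof -
  obtain K where K: "K \<noteq> 0" "K \<noteq> \<infinity>"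
    "\<And>S. S \<in> sets borel \<Longrightarrow> K * emeasure (muB kap kapd) S
      = (\<integral>\<^sup>+z. ennreal (hweight kap kapd (central_proj z)) * indicator S (central_proj z) * indicator shell z \<partial>lborel)"
    using cone_measure by blast
  define C where "C = (\<Prod>i\<in>UNIV. 6 powr (2 * kap $ i)) * 36 powr kapd"
  define D where "D = C * 3 ^ DIM((real^'n) \<times> real)"
  have C: "C > 0" unfolding C_def by (intro mult_pos_pos prod_pos) auto
  have "emeasure (muB kap kapd) (octcap x \<theta>) \<le> ennreal D * emeasure (muB kap kapd) (octcap x (\<theta>/2))"
    if x: "x \<in> cball 0 1" and \<theta>: "\<theta> \<in> {0<..pi}" for x \<theta>
  proof -
    let ?F = "\<lambda>\<theta> z. ennreal (hweight kap kapd (central_proj z)) * indicator (octcap x \<theta>) (central_proj z) * indicator shell z"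
    have pt: "?F \<theta> z \<le> ennreal C * ?F (\<theta>/2) (contract x z)" for z
    proof (cases "z \<in> shell \<and> central_proj z \<in> octcap x \<theta>")
      case True
      then have z: "z \<in> shell" and y: "central_proj z \<in> octcap x \<theta>" by auto
      let ?y = "central_proj z" and ?y' = "central_proj (contract x z)"
      note c = contract_octcap[OF x z y \<theta>]
      have "hweight kap kapd ?y \<le> (\<Prod>i\<in>UNIV. 6 powr (2 * kap $ i) * (if kap $ i = 0 then 1 else \<bar>?y' $ i\<bar> powr (2 * kap $ i)))
          * (36 powr kapd * (1 - (norm ?y')\<^sup>2) powr kapd)"
        unfolding hweight_def
      proof (intro mult_mono prod_mono conjI)
        fix i
        show "(if kap $ i = 0 then 1 else \<bar>?y $ i\<bar> powr (2 * kap $ i))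
            \<le> 6 powr (2 * kap $ i) * (if kap $ i = 0 then 1 else \<bar>?y' $ i\<bar> powr (2 * kap $ i))"
        proof (cases "kap $ i = 0")
          case False
          have "\<bar>?y $ i\<bar> powr (2 * kap $ i) \<le> (6 * \<bar>?y' $ i\<bar>) powr (2 * kap $ i)"
            using c(3)[of i] kap by (intro powr_mono2) auto
          then show ?thesis using False by (simp add: powr_mult)
        qed simp
        have "0 \<le> 1 - (norm ?y)\<^sup>2" using central_proj_shell(1)[OF z] by simp
        then have "(1 - (norm ?y)\<^sup>2) powr kapd \<le> (36 * (1 - (norm ?y')\<^sup>2)) powr kapd"
          using c(4) kapd by (intro powr_mono2) auto
        then show "(1 - (norm ?y)\<^sup>2) powr kapd \<le> 36 powr kapd * (1 - (norm ?y')\<^sup>2) powr kapd"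
          by (simp only: powr_mult)
      qed (auto intro!: prod_nonneg)
      also have "\<dots> = C * hweight kap kapd ?y'"
        by (simp add: C_def hweight_def prod.distrib)
      finally show ?thesis using c(1,2) True C by (simp add: ennreal_mult'[symmetric] ennreal_leI)
    qed auto
    have [measurable]: "?F (\<theta>/2) \<in> borel_measurable borel" by measurable
    have "K * emeasure (muB kap kapd) (octcap x \<theta>) = (\<integral>\<^sup>+z. ?F \<theta> z \<partial>lborel)"
      by (rule K(3)) simp
    also have "\<dots> \<le> (\<integral>\<^sup>+z. ennreal C * ?F (\<theta>/2) (contract x z) \<partial>lborel)"
      by (intro nn_integral_mono pt)
    also have "\<dots> = ennreal C * (\<integral>\<^sup>+z. ?F (\<theta>/2) (contract x z) \<partial>lborel)"
      unfolding contract_def by (intro nn_integral_cmult) measurable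
    also have "(\<integral>\<^sup>+z. ?F (\<theta>/2) (contract x z) \<partial>lborel) = ennreal (3 ^ DIM((real^'n) \<times> real)) * (\<integral>\<^sup>+z. ?F (\<theta>/2) z \<partial>lborel)"
    proof -
      have "(\<integral>\<^sup>+z. ?F (\<theta>/2) z \<partial>lborel) = ennreal (\<bar>1/3\<bar> ^ DIM((real^'n) \<times> real))
          * (\<integral>\<^sup>+z. ?F (\<theta>/2) (contract x z) \<partial>lborel)"
        unfolding contract_def by (rule nn_integral_lborel_affine) auto
      moreover have "ennreal (3 ^ DIM((real^'n) \<times> real)) * ennreal (\<bar>1/3\<bar> ^ DIM((real^'n) \<times> real)) = 1"
        by (subst ennreal_mult[symmetric]) (auto simp: power_mult_distrib[symmetric])
      ultimately show ?thesis by (simp only: mult.assoc[symmetric] mult_1_left)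
    qed
    also have "(\<integral>\<^sup>+z. ?F (\<theta>/2) z \<partial>lborel) = K * emeasure (muB kap kapd) (octcap x (\<theta>/2))"
      by (rule K(3)[symmetric]) simp
    finally have "K * emeasure (muB kap kapd) (octcap x \<theta>) \<le> K * (ennreal D * emeasure (muB kap kapd) (octcap x (\<theta>/2)))"
      using C by (simp add: D_def ennreal_mult mult_ac)
    then show ?thesis using ennreal_mult_le_mult_iff[of K] K(1,2) by simp
  qed
  moreover have "D > 0" using C by (simp add: D_def)
  ultimately show ?thesis by blast
qed

section \<open>Sign changes and the maximal functions\<close>

abbreviation (input) sign_vectors :: "(real^'n) set" where
  "sign_vectors \<equiv> {\<epsilon>. \<forall>i. \<epsilon> $ i = 1 \<or> \<epsilon> $ i = -1}"

lemma finite_sign_vectors: "finite (sign_vectors :: (real^'n) set)"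
proof (rule finite_subset)
  show "(sign_vectors :: (real^'n) set) \<subseteq> vec_lambda ` (PiE UNIV (\<lambda>_. {1, -1}))"
  proof
    fix \<epsilon> :: "real^'n" assume "\<epsilon> \<in> sign_vectors"
    then have "vec_nth \<epsilon> \<in> PiE UNIV (\<lambda>_. {1, -1})" by auto
    then show "\<epsilon> \<in> vec_lambda ` (PiE UNIV (\<lambda>_. {1, -1}))"
      by (intro image_eqI[of _ _ "vec_nth \<epsilon>"]) auto
  qed
  show "finite (vec_lambda ` (PiE (UNIV :: 'n set) (\<lambda>_. {1, -1 :: real})))"
    by (intro finite_imageI finite_PiE) auto
qed

lemma sign_vector_abs:
  assumes "\<epsilon> \<in> sign_vectors"
  shows "\<bar>\<epsilon> $ i\<bar> = 1" "\<epsilon> $ i * \<epsilon> $ i = 1"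
  using assms by (auto dest: spec[of _ i])

lemma norm_mult_sign:
  assumes "\<epsilon> \<in> sign_vectors"
  shows "norm (y * \<epsilon>) = norm y"
proof -
  have "(\<epsilon> $ i)\<^sup>2 = 1" for i using sign_vector_abs(2)[OF assms] by (simp add: power2_eq_square)
  then have "(norm (y * \<epsilon>))\<^sup>2 = (norm y)\<^sup>2" by (simp add: norm_vec_sq power_mult_distrib)
  then show ?thesis by simp
qed

text \<open>Multiplication in \<open>real^'n\<close> is componentwise, so this is invariance of
  Lebesgue measure under a diagonal map with entries of modulus 1.\<close>

lemma nn_integral_mult_sign:
  fixes F :: "real^'n \<Rightarrow> ennreal"
  assumes [measurable]: "F \<in> borel_measurable borel" and \<epsilon>: "\<epsilon> \<in> sign_vectors"
  shows "(\<integral>\<^sup>+y. F (y * \<epsilon>) \<partial>lborel) = (\<integral>\<^sup>+y. F y \<partial>lborel)"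
proof -
  let ?T = "\<lambda>y::real^'n. 0 + (\<Sum>j\<in>Basis. ((\<epsilon> \<bullet> j) * (y \<bullet> j)) *\<^sub>R j)"
  have T: "?T = (\<lambda>y. y * \<epsilon>)"
  proof (rule ext, rule euclidean_eqI)
    fix y b :: "real^'n" assume b: "b \<in> Basis"
    then have "?T y \<bullet> b = (\<epsilon> \<bullet> b) * (y \<bullet> b)" by (simp add: inner_sum_left_Basis)
    also obtain i where "b = axis i 1" using b by (auto simp: Basis_vec_def)
    then have "(\<epsilon> \<bullet> b) * (y \<bullet> b) = (y * \<epsilon>) \<bullet> b" by (simp add: inner_axis)
    finally show "?T y \<bullet> b = (y * \<epsilon>) \<bullet> b" .
  qed
  have one: "\<bar>\<epsilon> \<bullet> j\<bar> = 1" if "j \<in> Basis" for j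
    using that sign_vector_abs(1)[OF \<epsilon>] by (auto simp: Basis_vec_def inner_axis)
  have [measurable]: "(\<lambda>y. y * \<epsilon>) \<in> borel_measurable borel"
    unfolding T[symmetric] by measurable
  have "lborel = density (distr lborel borel ?T) (\<lambda>_. (\<Prod>j\<in>Basis. \<bar>\<epsilon> \<bullet> j\<bar>))"
    using one by (intro lborel_affine_euclidean) fastforce
  moreover have "(\<Prod>j\<in>Basis. \<bar>\<epsilon> \<bullet> j\<bar>) = 1" by (simp add: one)
  ultimately have "lborel = density (distr lborel borel (\<lambda>y. y * \<epsilon>)) (\<lambda>_. ennreal 1)"
    by (simp only: T)
  then have "lborel = distr lborel borel (\<lambda>y. y * \<epsilon>)" by (simp add: density_1)
  then have "(\<integral>\<^sup>+y. F y \<partial>lborel) = (\<integral>\<^sup>+y. F y \<partial>distr lborel borel (\<lambda>y. y * \<epsilon>))" by simp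
  also have "\<dots> = (\<integral>\<^sup>+y. F (y * \<epsilon>) \<partial>lborel)" by (rule nn_integral_distr) measurable
  finally show ?thesis ..
qed

text \<open>The density depends only on the norm and the moduli of the coordinates, which sign
  changes preserve.\<close>

lemma emeasure_muB_mult_sign:
  fixes S :: "(real^'n) set"
  assumes [measurable]: "S \<in> sets borel" and \<epsilon>: "\<epsilon> \<in> sign_vectors"
    and S': "{y. y * \<epsilon> \<in> S} \<in> sets borel"
  shows "emeasure (muB kap kapd) {y. y * \<epsilon> \<in> S} = emeasure (muB kap kapd) S"
proof -
  let ?F = "\<lambda>y. (ennreal (hweight kap kapd y) * indicator S y) * indicator (ball 0 1) y
    * ennreal (1 / sqrt (1 - (norm y)\<^sup>2))"
  have [measurable]: "ball 0 1 \<in> sets (borel :: (real^'n) measure)" by simp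
  have m: "?F \<in> borel_measurable borel" by measurable
  have "\<bar>(y * \<epsilon>) $ i\<bar> = \<bar>y $ i\<bar>" for y i
    using sign_vector_abs(1)[OF \<epsilon>] by (simp add: abs_mult)
  then have h: "hweight kap kapd (y * \<epsilon>) = hweight kap kapd y" for y
    by (simp only: hweight_def norm_mult_sign[OF \<epsilon>])
  have "emeasure (muB kap kapd) {y. y * \<epsilon> \<in> S} = (\<integral>\<^sup>+y. ?F (y * \<epsilon>) \<partial>lborel)"
    unfolding emeasure_muB[OF S'] h norm_mult_sign[OF \<epsilon>]
    by (intro nn_integral_cong) (simp add: indicator_def norm_mult_sign[OF \<epsilon>])
  also have "\<dots> = (\<integral>\<^sup>+y. ?F y \<partial>lborel)" by (rule nn_integral_mult_sign[OF m \<epsilon>])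
  also have "\<dots> = emeasure (muB kap kapd) S" by (rule emeasure_muB[symmetric]) simp
  finally show ?thesis .
qed

lemma sign_choice:
  fixes x y :: "real^'n"
  obtains \<epsilon> where "\<epsilon> \<in> sign_vectors" "\<And>i. x $ i * (y * \<epsilon>) $ i = \<bar>x $ i * y $ i\<bar>"
proof
  let ?e = "\<chi> i. if 0 \<le> x $ i * y $ i then 1 else -1"
  show "?e \<in> sign_vectors" by simp
  show "x $ i * (y * ?e) $ i = \<bar>x $ i * y $ i\<bar>" for i by auto
qed

text \<open>Sign changes move every point of the folded cap into the octant of \<open>x\<close>, so
  its reflected copies, all of equal measure, cover the folded cap.\<close>

lemma foldcap_le_octcap:
  fixes kap :: "real^'n"
  shows "emeasure (muB kap kapd) (foldcap x \<theta>)
    \<le> of_nat (card (sign_vectors :: (real^'n) set)) * emeasure (muB kap kapd) (octcap x \<theta>)"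
proof -
  let ?S = "\<lambda>\<epsilon>. {y. y * \<epsilon> \<in> octcap x \<theta>}"
  have S: "?S \<epsilon> \<in> sets borel" if "\<epsilon> \<in> sign_vectors" for \<epsilon>
  proof -
    have "(\<lambda>y. y * \<epsilon>) \<in> borel_measurable borel"
      by (subst borel_measurable_euclidean_space) (auto simp: Basis_vec_def inner_axis)
    from measurable_sets[OF this octcap_borel[of x \<theta>]] show ?thesis by (simp add: vimage_def)
  qed
  have "foldcap x \<theta> \<subseteq> (\<Union>\<epsilon>\<in>sign_vectors. ?S \<epsilon>)"
  proof
    fix y assume y: "y \<in> foldcap x \<theta>"
    obtain \<epsilon> where \<epsilon>: "\<epsilon> \<in> sign_vectors" "\<And>i. x $ i * (y * \<epsilon>) $ i = \<bar>x $ i * y $ i\<bar>"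
      using sign_choice[of x y] by blast
    have "lastc (y * \<epsilon>) = lastc y" "norm (y * \<epsilon>) = norm y"
      using norm_mult_sign[OF \<epsilon>(1), of y] by (auto simp: lastc_def)
    then have "y * \<epsilon> \<in> octcap x \<theta>" using y \<epsilon>(2) unfolding octcap_def foldcap_def by simp
    then show "y \<in> (\<Union>\<epsilon>\<in>sign_vectors. ?S \<epsilon>)" using \<epsilon>(1) by blast
  qed
  then have "emeasure (muB kap kapd) (foldcap x \<theta>) \<le> emeasure (muB kap kapd) (\<Union>\<epsilon>\<in>sign_vectors. ?S \<epsilon>)"
    using S finite_sign_vectors by (intro emeasure_mono) (auto intro!: sets.finite_UN)
  also have "\<dots> \<le> (\<Sum>\<epsilon>\<in>sign_vectors. emeasure (muB kap kapd) (?S \<epsilon>))"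
    using S finite_sign_vectors by (intro emeasure_subadditive_finite) auto
  also have "\<dots> = (\<Sum>\<epsilon>\<in>(sign_vectors :: (real^'n) set). emeasure (muB kap kapd) (octcap x \<theta>))"
    using S by (intro sum.cong emeasure_muB_mult_sign) auto
  finally show ?thesis by simp
qed

lemma arccos_measurable [measurable]: "arccos \<in> borel_measurable borel"
proof -
  \<comment> \<open>Outside [-1,1] the description defining \<open>arccos\<close> has an identically
    false predicate, so its value there is one fixed constant.\<close>
  have "arccos = (\<lambda>y. if y \<in> {-1..1} then arccos y else (THE x. False))"
  proof
    fix y :: real
    show "arccos y = (if y \<in> {-1..1} then arccos y else (THE x. False))"
    proof (cases "y \<in> {-1..1}")
      case False
      then have "(\<lambda>x. 0 \<le> x \<and> x \<le> pi \<and> cos x = y) = (\<lambda>x. False)"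
        by (intro ext) auto
      then show ?thesis using False by (simp add: arccos_def)
    qed simp
  qed
  also have "\<dots> \<in> borel_measurable borel"
    by (intro borel_measurable_continuous_on_if continuous_on_arccos' continuous_intros) auto
  finally show ?thesis .
qed

lemma dB_cap_borel [measurable]: "{y. dB x y \<le> \<theta>} \<in> sets borel"
  unfolding dB_def by measurable

text \<open>By Cauchy-Schwarz for the lifted unit vectors the argument of \<open>arccos\<close> lies
  in [-1,1], where the cosine inverts it monotonically.\<close>

lemma dB_le_iff:
  assumes x: "x \<in> cball 0 1" and y: "y \<in> cball 0 1" and \<theta>: "0 \<le> \<theta>" "\<theta> \<le> pi"
  shows "dB x y \<le> \<theta> \<longleftrightarrow> cos \<theta> \<le> inner x y + lastc x * lastc y"
proof -
  let ?u = "inner x y + lastc x * lastc y"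
  have "\<bar>inner (x, lastc x) (y, lastc y)\<bar> \<le> norm (x, lastc x) * norm (y, lastc y)"
    by (rule Cauchy_Schwarz_ineq2)
  moreover have "norm (x, lastc x) = 1" "norm (y, lastc y) = 1"
    using lastc_sq[OF x] lastc_sq[OF y] by (simp_all add: norm_Pair)
  ultimately have u: "-1 \<le> ?u" "?u \<le> 1" by (auto simp: abs_le_iff)
  have "arccos ?u \<le> \<theta> \<longleftrightarrow> cos \<theta> \<le> cos (arccos ?u)"
    using arccos_bounded[OF u] \<theta> by (subst cos_mono_le_eq) auto
  then show ?thesis using u by (simp add: dB_def lastc_def)
qed

lemma AE_muB_cball: "AE y in muB kap kapd. y \<in> cball 0 1"
proof -
  have [measurable]: "cball 0 1 \<in> sets (borel :: (real^'n) measure)" by simp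
  have "(\<lambda>y. ennreal (indicator (cball 0 1) y * WB kap kapd y)) \<in> borel_measurable borel" by measurable
  then show ?thesis unfolding muB_def by (subst AE_density) (auto simp: indicator_def)
qed

text \<open>The set on the left is not restricted to the unit ball, so the inclusion is used almost
  everywhere. Within the ball it holds because the inner product with \<open>x * \<epsilon>\<close>
  is at most the folded one.\<close>

lemma emeasure_dB_cap_le:
  assumes x: "x \<in> cball 0 1" and \<theta>: "\<theta> \<in> {0<..pi}" and \<epsilon>: "\<epsilon> \<in> sign_vectors"
  shows "emeasure (muB kap kapd) {y. dB (x * \<epsilon>) y \<le> \<theta>} \<le> emeasure (muB kap kapd) (foldcap x \<theta>)"
proof (rule emeasure_mono_AE)
  have xe: "x * \<epsilon> \<in> cball 0 1" "lastc (x * \<epsilon>) = lastc x"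
    using x norm_mult_sign[OF \<epsilon>, of x] by (auto simp: lastc_def)
  have le: "inner (x * \<epsilon>) y \<le> (\<Sum>i\<in>UNIV. \<bar>x $ i * y $ i\<bar>)" for y
    unfolding inner_vec_def
  proof (intro sum_mono)
    fix i
    have "\<bar>(x * \<epsilon>) $ i * y $ i\<bar> = \<bar>x $ i * y $ i\<bar>"
      using sign_vector_abs(1)[OF \<epsilon>] by (simp add: abs_mult)
    then show "inner ((x * \<epsilon>) $ i) (y $ i) \<le> \<bar>x $ i * y $ i\<bar>"
      using abs_ge_self[of "(x * \<epsilon>) $ i * y $ i"] by simp
  qed
  show "AE y in muB kap kapd. y \<in> {y. dB (x * \<epsilon>) y \<le> \<theta>} \<longrightarrow> y \<in> foldcap x \<theta>"
    using AE_muB_cball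
  proof eventually_elim
    case (elim y)
    then show ?case using dB_le_iff[OF xe(1) elim, of \<theta>] \<theta> xe(2) le[of y] by (auto simp: foldcap_def)
  qed
qed simp

text \<open>The signs that fold \<open>y\<close> into the octant of \<open>x\<close> can be moved to
  \<open>x\<close>, as the inner product treats both factors alike.\<close>

lemma foldcap_cover:
  assumes x: "x \<in> cball 0 1" and \<theta>: "\<theta> \<in> {0<..pi}" and y: "y \<in> foldcap x \<theta>"
  shows "\<exists>\<epsilon>\<in>sign_vectors. dB (x * \<epsilon>) y \<le> \<theta>"
proof -
  obtain \<epsilon> where \<epsilon>: "\<epsilon> \<in> sign_vectors" "\<And>i. x $ i * (y * \<epsilon>) $ i = \<bar>x $ i * y $ i\<bar>"
    using sign_choice[of x y] by blast
  have xe: "x * \<epsilon> \<in> cball 0 1" "lastc (x * \<epsilon>) = lastc x"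
    using x norm_mult_sign[OF \<epsilon>(1), of x] by (auto simp: lastc_def)
  have "inner (x * \<epsilon>) y = (\<Sum>i\<in>UNIV. x $ i * (y * \<epsilon>) $ i)" by (simp add: inner_vec_def mult_ac)
  also have "\<dots> = (\<Sum>i\<in>UNIV. \<bar>x $ i * y $ i\<bar>)" by (simp only: \<epsilon>(2))
  finally have "dB (x * \<epsilon>) y \<le> \<theta>"
    using y \<theta> xe by (subst dB_le_iff) (auto simp: foldcap_def)
  then show ?thesis using \<epsilon>(1) by blast
qed

text \<open>Cover the folded cap by the balls around the points \<open>x * \<epsilon>\<close>. The
  integral over each ball is its average times its measure; the average is at most
  \<open>MB\<close>, the measure at most that of the folded cap.\<close>

lemma foldcap_integral_le_MB:
  fixes kap :: "real^'n" and f :: "real^'n \<Rightarrow> real"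
  assumes kap: "\<And>i. kap $ i \<ge> 0" "kapd \<ge> 0" and f: "f \<in> borel_measurable borel"
    and x: "x \<in> cball 0 1" and \<theta>: "\<theta> \<in> {0<..pi}"
  shows "(\<integral>\<^sup>+y. ennreal \<bar>f y\<bar> * indicator (foldcap x \<theta>) y \<partial>muB kap kapd)
    \<le> (\<Sum>\<epsilon>\<in>sign_vectors. MB kap kapd f (x * \<epsilon>)) * emeasure (muB kap kapd) (foldcap x \<theta>)"
proof -
  let ?\<mu> = "muB kap kapd"
  let ?I = "\<lambda>\<epsilon>. \<integral>\<^sup>+y. ennreal (\<bar>f y\<bar> * indicator {y. dB (x * \<epsilon>) y \<le> \<theta>} y) \<partial>?\<mu>"
  note [measurable] = f
  have one: "?I \<epsilon> \<le> MB kap kapd f (x * \<epsilon>) * emeasure ?\<mu> (foldcap x \<theta>)" if \<epsilon>: "\<epsilon> \<in> sign_vectors" for \<epsilon>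
  proof -
    let ?B = "{y. dB (x * \<epsilon>) y \<le> \<theta>}"
    \<comment> \<open>Cancelling needs a measure that is neither 0 nor infinite. For a null ball the
      right side is 0, so the integral has to be shown to vanish as well.\<close>
    have "?I \<epsilon> \<le> ?I \<epsilon> / emeasure ?\<mu> ?B * emeasure ?\<mu> ?B"
    proof (cases "emeasure ?\<mu> ?B = 0")
      case True
      then have "AE y in ?\<mu>. y \<notin> ?B" by (intro AE_not_in) (auto simp: null_sets_def)
      then have "AE y in ?\<mu>. ennreal (\<bar>f y\<bar> * indicator ?B y) = 0" by eventually_elim auto
      then have "?I \<epsilon> = 0" by (subst nn_integral_0_iff_AE) auto
      then show ?thesis by simp
    next
      case False
      then show ?thesis using finite_muB[OF kap, of ?B]
        by (simp add: ennreal_divide_times ennreal_divide_self top.not_eq_extremum)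
    qed
    also have "\<dots> \<le> MB kap kapd f (x * \<epsilon>) * emeasure ?\<mu> (foldcap x \<theta>)"
      unfolding MB_def using \<theta> by (intro mult_mono SUP_upper2[of \<theta>] emeasure_dB_cap_le[OF x \<theta> \<epsilon>]) auto
    finally show ?thesis .
  qed
  have "(\<integral>\<^sup>+y. ennreal \<bar>f y\<bar> * indicator (foldcap x \<theta>) y \<partial>?\<mu>)
      \<le> (\<integral>\<^sup>+y. (\<Sum>\<epsilon>\<in>sign_vectors. ennreal (\<bar>f y\<bar> * indicator {y. dB (x * \<epsilon>) y \<le> \<theta>} y)) \<partial>?\<mu>)"
  proof (intro nn_integral_mono)
    fix y
    show "ennreal \<bar>f y\<bar> * indicator (foldcap x \<theta>) y
        \<le> (\<Sum>\<epsilon>\<in>sign_vectors. ennreal (\<bar>f y\<bar> * indicator {y. dB (x * \<epsilon>) y \<le> \<theta>} y))"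
    proof (cases "y \<in> foldcap x \<theta>")
      case True
      then obtain \<epsilon> where \<epsilon>: "\<epsilon> \<in> sign_vectors" "dB (x * \<epsilon>) y \<le> \<theta>" using foldcap_cover[OF x \<theta>] by blast
      have "ennreal \<bar>f y\<bar> * indicator (foldcap x \<theta>) y = ennreal (\<bar>f y\<bar> * indicator {y. dB (x * \<epsilon>) y \<le> \<theta>} y)"
        using True \<epsilon> by simp
      also have "\<dots> \<le> (\<Sum>\<epsilon>\<in>sign_vectors. ennreal (\<bar>f y\<bar> * indicator {y. dB (x * \<epsilon>) y \<le> \<theta>} y))"
        using \<epsilon>(1) finite_sign_vectors by (intro member_le_sum) auto
      finally show ?thesis .
    qed simp
  qed
  also have "\<dots> = (\<Sum>\<epsilon>\<in>sign_vectors. ?I \<epsilon>)" by (intro nn_integral_sum) measurable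
  also have "\<dots> \<le> (\<Sum>\<epsilon>\<in>sign_vectors. MB kap kapd f (x * \<epsilon>) * emeasure ?\<mu> (foldcap x \<theta>))"
    by (intro sum_mono one)
  finally show ?thesis by (simp add: sum_distrib_right)
qed

theorem theorem4p3:
  fixes kap :: "real^'n" and kapd :: real
  assumes "\<forall>i. kap $ i \<ge> 0" and "kapd \<ge> 0"
  shows "\<exists>c::real. \<forall>f::real^'n \<Rightarrow> real. integrable (muB kap kapd) f \<longrightarrow>
           (\<forall>x\<in>cball 0 1. calMB kap kapd f x
              \<le> ennreal c * (\<Sum>\<epsilon>\<in>{\<epsilon>::real^'n. \<forall>i. \<epsilon> $ i = 1 \<or> \<epsilon> $ i = -1}. MB kap kapd f (x * \<epsilon>)))"
proof -
  have kap: "\<And>i. kap $ i \<ge> 0" using assms by simp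
  note kapd = assms(2)
  let ?\<mu> = "muB kap kapd"
  obtain C where C: "C > 0" "\<And>x \<theta> y. x \<in> cball 0 1 \<Longrightarrow> \<theta> > 0 \<Longrightarrow> y \<in> cball 0 1 \<Longrightarrow>
      VBk kap kapd (indicator (ecap x \<theta>)) (liftY y) \<le> C * capfactor kap kapd x \<theta> * indicator (foldcap x \<theta>) y"
    using VBk_ecap_le[OF kap kapd] by blast
  obtain c where c: "c > 0" "\<And>x \<theta> y. x \<in> cball 0 1 \<Longrightarrow> \<theta> \<in> {0<..pi} \<Longrightarrow> y \<in> octcap x (\<theta>/2) \<Longrightarrow>
      c * capfactor kap kapd x \<theta> \<le> VBk kap kapd (indicator (ecap x \<theta>)) (liftY y)"
    using VBk_ecap_ge[OF kap kapd] by blast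
  obtain D where D: "D > 0" "\<And>x \<theta>. x \<in> cball 0 1 \<Longrightarrow> \<theta> \<in> {0<..pi} \<Longrightarrow>
      emeasure ?\<mu> (octcap x \<theta>) \<le> ennreal D * emeasure ?\<mu> (octcap x (\<theta>/2))"
    using octcap_doubling[OF kap kapd] by blast
  define N where "N = real (card (sign_vectors :: (real^'n) set))"
  \<comment> \<open>\<open>C / c\<close> compares the two bounds on \<open>VBk\<close>,
    \<open>N\<close> passes from the folded cap to one octant, and \<open>D\<close> from radius
    \<open>\<theta>\<close> to \<open>\<theta>/2\<close>.\<close>
  define E where "E = C / c * N * D"
  have N: "N \<ge> 0" by (simp add: N_def)
  have "calMB kap kapd f x \<le> ennreal E * (\<Sum>\<epsilon>\<in>sign_vectors. MB kap kapd f (x * \<epsilon>))"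
    if f: "integrable ?\<mu> f" and x: "x \<in> cball 0 1" for f x
    unfolding calMB_def
  proof (rule SUP_least)
    fix \<theta> assume \<theta>: "\<theta> \<in> {0<..pi}"
    let ?A = "capfactor kap kapd x \<theta>" and ?V = "\<lambda>y. VBk kap kapd (indicator (ecap x \<theta>)) (liftY y)"
    let ?S = "\<Sum>\<epsilon>\<in>sign_vectors. MB kap kapd f (x * \<epsilon>)"
    let ?m = "emeasure ?\<mu> (octcap x (\<theta>/2))"
    let ?num = "\<integral>\<^sup>+y. ennreal (\<bar>f y\<bar> * ?V y) \<partial>?\<mu>" and ?den = "\<integral>\<^sup>+y. ennreal (?V y) \<partial>?\<mu>"
    have [measurable]: "f \<in> borel_measurable borel"
      using f borel_measurable_integrable measurable_cong_sets[OF sets_muB refl] by blast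
    have A: "?A \<ge> 0" by (rule capfactor_nonneg)
    have "?num \<le> (\<integral>\<^sup>+y. ennreal (C * ?A) * (ennreal \<bar>f y\<bar> * indicator (foldcap x \<theta>) y) \<partial>?\<mu>)"
    proof (rule nn_integral_mono_AE)
      show "AE y in ?\<mu>. ennreal (\<bar>f y\<bar> * ?V y) \<le> ennreal (C * ?A) * (ennreal \<bar>f y\<bar> * indicator (foldcap x \<theta>) y)"
        using AE_muB_cball
      proof eventually_elim
        case (elim y)
        have "\<bar>f y\<bar> * ?V y \<le> \<bar>f y\<bar> * (C * ?A * indicator (foldcap x \<theta>) y)"
          using C(2)[OF x _ elim, of \<theta>] \<theta> by (intro mult_left_mono) auto
        also have "ennreal \<dots> = ennreal (C * ?A) * (ennreal \<bar>f y\<bar> * indicator (foldcap x \<theta>) y)"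
          using A C(1) by (auto simp: indicator_def ennreal_mult'[symmetric] mult_ac)
        finally show ?case by (simp add: ennreal_leI)
      qed
    qed
    also have "\<dots> = ennreal (C * ?A) * (\<integral>\<^sup>+y. ennreal \<bar>f y\<bar> * indicator (foldcap x \<theta>) y \<partial>?\<mu>)"
      by (rule nn_integral_cmult) measurable
    also have "\<dots> \<le> ennreal (C * ?A) * (?S * emeasure ?\<mu> (foldcap x \<theta>))"
      by (intro mult_left_mono foldcap_integral_le_MB[OF kap kapd _ x \<theta>]) auto
    also have "\<dots> \<le> ennreal (C * ?A) * (?S * (ennreal N * (ennreal D * emeasure ?\<mu> (octcap x (\<theta>/2)))))"
    proof (intro mult_left_mono)
      have "emeasure ?\<mu> (foldcap x \<theta>) \<le> ennreal N * emeasure ?\<mu> (octcap x \<theta>)"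
        using foldcap_le_octcap[of kap kapd x \<theta>] by (simp add: N_def ennreal_of_nat_eq_real_of_nat)
      also have "\<dots> \<le> ennreal N * (ennreal D * emeasure ?\<mu> (octcap x (\<theta>/2)))"
        by (intro mult_left_mono D(2)[OF x \<theta>]) auto
      finally show "emeasure ?\<mu> (foldcap x \<theta>) \<le> ennreal N * (ennreal D * emeasure ?\<mu> (octcap x (\<theta>/2)))" .
    qed auto
    \<comment> \<open>Regrouped so that \<open>capfactor\<close> joins the half cap: together with
      \<open>c\<close> they form the lower bound for the denominator.\<close>
    also have "\<dots> = ennreal E * ?S * (ennreal (c * ?A) * emeasure ?\<mu> (octcap x (\<theta>/2)))"
    proof -
      have "C * ?A * N * D = E * (c * ?A)" using c(1) by (simp add: E_def)
      then have "ennreal (C * ?A) * ennreal N * ennreal D = ennreal E * ennreal (c * ?A)"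
        using A C(1) c(1) D(1) N by (simp add: ennreal_mult[symmetric] E_def)
      then have "ennreal (C * ?A) * ennreal N * ennreal D * (?S * ?m) = ennreal E * ennreal (c * ?A) * (?S * ?m)"
        by (simp only:)
      then show ?thesis by (simp only: mult_ac)
    qed
    also have "ennreal (c * ?A) * emeasure ?\<mu> (octcap x (\<theta>/2)) \<le> ?den"
    proof -
      have "ennreal (c * ?A) * emeasure ?\<mu> (octcap x (\<theta>/2))
          = (\<integral>\<^sup>+y. ennreal (c * ?A) * indicator (octcap x (\<theta>/2)) y \<partial>?\<mu>)"
        by (rule nn_integral_cmult_indicator[symmetric]) simp
      also have "\<dots> \<le> ?den"
        using c(2)[OF x \<theta>] by (intro nn_integral_mono) (auto simp: indicator_def intro!: ennreal_leI)
      finally show ?thesis .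
    qed
    finally have main: "?num \<le> ennreal E * ?S * ?den" by (simp add: mult_left_mono)
    show "?num / ?den \<le> ennreal E * ?S"
    \<comment> \<open>A zero denominator forces a zero numerator by \<open>main\<close>, and 0/0 is
      0 here; division by infinity also gives 0.\<close>
    proof (cases "?den = 0 \<or> ?den = \<infinity>")
      case True
      then show ?thesis using main by (auto simp: ennreal_divide_top)
    next
      case False
      then show ?thesis using main
        by (intro divide_le_posI_ennreal) (auto simp: mult.commute zero_less_iff_neq_zero)
    qed
  qed
  then show ?thesis by blast
qed

end
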